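(* Let $k \ge 1$ be an integer, $\epsilon > 0$, and $\mathbb{F}$ a finite field. Let $m := k/\epsilon$ and assume $m$ is an integer dividing $n$. Let $A$ be a $k \times m$ matrix with entries in $\mathbb{F}$ which is strongly-regular, and let $d_1 > d_2 > \cdots > d_m \ge 1$ be integers. For $i \in [k]$ let $$f_i(x_1,\ldots,x_m) := \sum_{j=1}^m A_{i,j}\, x_j^{d_j},$$ and let $$S := \{x \in \mathbb{F}^n : f_i(x_{tm+1},\ldots,x_{tm+m}) = 0 \text{ for all } 0 \le t < n/m,\ 1 \le i \le k\},$$ i.e. the $(n/m)$-fold Cartesian product of $\mathbf{V}_{\mathbb{F}}(f_1,\ldots,f_k) = \{y\in\mathbb{F}^m : f_1(y)=\cdots=f_k(y)=0\}$. Then $S$ is $(k, d_1^k)$-subspace evasive. Moreover: (1) if $\epsilon \le 1/10$, $d_1 \le |\mathbb{F}|^{1/4}$ and $|\mathbb{F}|^m \ge n^8$, then $|S| \ge \frac{1}{3}|\mathbb{F}|^{(1-\epsilon)n}$; (2) if at least $k$ of the degrees $d_1,\ldots,d_m$ are coprime to $|\mathbb{F}|-1$, then $|S| = |\mathbb{F}|^{(1-\epsilon)n}$.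
   Context: A $k \times m$ matrix is strongly-regular if all its $r \times r$ minors are nonzero for every $1 \le r \le k$. A set $S \subset \mathbb{F}^n$ is $(k,c)$-subspace evasive if $|S \cap H| \le c$ for every $k$-dimensional affine subspace $H \subset \mathbb{F}^n$. *)

theory Defs
  imports
    Complex_Main
    "HOL-Library.FuncSet"
    "HOL-Library.Cardinality"
    "Jordan_Normal_Form.Determinant"
    "Jordan_Normal_Form.DL_Submatrix"
    "Jordan_Normal_Form.VS_Connect"
begin

text \<open>
  Vectors of \<open>\<bbbF>\<^sup>n\<close> are the elements of \<^term>\<open>carrier_vec n\<close>. All indices start at \<open>0\<close>:
  the rows \<open>1, \<dots>, k\<close>, the columns and degrees \<open>1, \<dots>, m\<close> and the coordinates
  \<open>1, \<dots>, n\<close> become \<open>{..<k}\<close>, \<open>{..<m}\<close> and \<open>{..<n}\<close>. In particular the largest degree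
  \<open>d\<^sub>1\<close> is \<open>d 0\<close>.
\<close>

definition strongly_regular :: "'a :: comm_ring_1 mat \<Rightarrow> bool" where
  "strongly_regular A \<longleftrightarrow>
     (\<forall>r I J. 1 \<le> r \<and> r \<le> dim_row A \<and>
        I \<subseteq> {..<dim_row A} \<and> card I = r \<and> J \<subseteq> {..<dim_col A} \<and> card J = r \<longrightarrow>
        det (submatrix A I J) \<noteq> 0)"

definition affine_subspace :: "nat \<Rightarrow> nat \<Rightarrow> 'a :: field vec set \<Rightarrow> bool" where
  "affine_subspace n k H \<longleftrightarrow>
     (\<exists>p W. p \<in> carrier_vec n \<and>
        VectorSpace.subspace class_ring W (module_vec TYPE('a) n) \<and>
        vectorspace.dim class_ring ((module_vec TYPE('a) n)\<lparr>carrier := W\<rparr>) = k \<and>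
        H = (\<lambda>w. p + w) ` W)"

definition subspace_evasive :: "nat \<Rightarrow> nat \<Rightarrow> nat \<Rightarrow> 'a :: field vec set \<Rightarrow> bool" where
  "subspace_evasive n k c S \<longleftrightarrow>
     S \<subseteq> carrier_vec n \<and>
     (\<forall>H. affine_subspace n k H \<longrightarrow> finite (S \<inter> H) \<and> card (S \<inter> H) \<le> c)"

definition diag_poly :: "'a :: comm_ring_1 mat \<Rightarrow> (nat \<Rightarrow> nat) \<Rightarrow> nat \<Rightarrow> 'a vec \<Rightarrow> 'a" where
  "diag_poly A d i y = (\<Sum>j<dim_col A. A $$ (i, j) * (y $ j) ^ d j)"

definition block :: "nat \<Rightarrow> nat \<Rightarrow> 'a vec \<Rightarrow> 'a vec" where
  "block m t x = vec m (\<lambda>j. x $ (t * m + j))"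

definition common_zeros :: "'a :: comm_ring_1 mat \<Rightarrow> (nat \<Rightarrow> nat) \<Rightarrow> 'a vec set" where
  "common_zeros A d =
     {y \<in> carrier_vec (dim_col A). \<forall>i<dim_row A. diag_poly A d i y = 0}"

definition evasive_set :: "nat \<Rightarrow> 'a :: comm_ring_1 mat \<Rightarrow> (nat \<Rightarrow> nat) \<Rightarrow> 'a vec set" where
  "evasive_set n A d =
     {x \<in> carrier_vec n. \<forall>t < n div dim_col A. \<forall>i < dim_row A.
        diag_poly A d i (block (dim_col A) t x) = 0}"

text \<open>\<^const>\<open>evasive_set\<close> is the \<open>n/m\<close>-fold Cartesian product of \<^const>\<open>common_zeros\<close>.\<close>

lemma evasive_set_bij_common_zeros:
  fixes A :: "'a :: comm_ring_1 mat"
  assumes m: "dim_col A > 0" and dvd: "dim_col A dvd n"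
  shows "bij_betw (\<lambda>x. \<lambda>t\<in>{..<n div dim_col A}. block (dim_col A) t x)
           (evasive_set n A d) ({..<n div dim_col A} \<rightarrow>\<^sub>E common_zeros A d)"
proof -
  define m where "m = dim_col A"
  define N where "N = n div m"
  have mpos: "m > 0" and n: "n = N * m"
    using m dvd by (auto simp: m_def N_def)
  have idx: "i div m < N" if "i < n" for i
    using that n mpos by (simp add: less_mult_imp_div_less)
  have idx': "t * m + j < n" if "t < N" "j < m" for t j
  proof -
    have "t * m + j < Suc t * m" using that by simp
    also have "\<dots> \<le> n" using that n by (metis Suc_leI mult_le_mono1)
    finally show ?thesis .
  qed
  define g :: "(nat \<Rightarrow> 'a vec) \<Rightarrow> 'a vec"
    where "g = (\<lambda>h. vec n (\<lambda>i. h (i div m) $ (i mod m)))"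
  have blk_g: "block m t (g h) = h t" if "t < N" "h t \<in> carrier_vec m" for t h
    using that mpos by (intro eq_vecI) (auto simp: block_def g_def idx')
  have g_blk: "g (\<lambda>t\<in>{..<N}. block m t x) = x" if "x \<in> carrier_vec n" for x
    using that mpos by (intro eq_vecI) (auto simp: block_def g_def idx)
  have "bij_betw (\<lambda>x. \<lambda>t\<in>{..<N}. block m t x)
           (evasive_set n A d) ({..<N} \<rightarrow>\<^sub>E common_zeros A d)"
  proof (rule bij_betw_byWitness[where f' = g])
    show "\<forall>x\<in>evasive_set n A d. g (\<lambda>t\<in>{..<N}. block m t x) = x"
      by (auto simp: evasive_set_def g_blk)
    show "\<forall>h\<in>{..<N} \<rightarrow>\<^sub>E common_zeros A d. (\<lambda>t\<in>{..<N}. block m t (g h)) = h"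
    proof
      fix h assume h: "h \<in> {..<N} \<rightarrow>\<^sub>E common_zeros A d"
      have "block m t (g h) = h t" if "t < N" for t
        using h that by (intro blk_g) (auto simp: common_zeros_def m_def)
      with h show "(\<lambda>t\<in>{..<N}. block m t (g h)) = h"
        by (auto simp: fun_eq_iff PiE_def extensional_def)
    qed
    show "(\<lambda>x. \<lambda>t\<in>{..<N}. block m t x) ` evasive_set n A d \<subseteq> {..<N} \<rightarrow>\<^sub>E common_zeros A d"
      by (auto simp: evasive_set_def common_zeros_def m_def N_def block_def)
    show "g ` ({..<N} \<rightarrow>\<^sub>E common_zeros A d) \<subseteq> evasive_set n A d"
    proof (rule image_subsetI)
      fix h assume h: "h \<in> {..<N} \<rightarrow>\<^sub>E common_zeros A d"
      have ht: "h t \<in> common_zeros A d" if "t < N" for t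
        using h that by auto
      have "block m t (g h) = h t" if "t < N" for t
        using ht[OF that] that by (intro blk_g) (auto simp: common_zeros_def m_def)
      with ht show "g h \<in> evasive_set n A d"
        by (auto simp: evasive_set_def common_zeros_def g_def m_def N_def)
    qed
  qed
  then show ?thesis by (simp add: N_def m_def)
qed

end

theory Submission
  imports Defs "HOL-Number_Theory.Cong"
begin

text \<open>
  Evasiveness. Let \<open>H\<close> be affine of dimension \<open>k\<close>, with pivot coordinates \<open>J\<close>: every other coordinate
  is on \<open>H\<close> an affine function of the pivots to its left. Inside each block, invert the minor of \<open>A\<close>
  on the pivot columns. On \<open>S \<inter> H\<close> this writes \<open>x\<^sub>s ^ D\<^sub>s\<close>, for a pivot \<open>s\<close> of degree \<open>D\<^sub>s\<close>, as a
  polynomial in the pivots of smaller weight, for suitable weights: a non-pivot to the right of a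
  pivot has a smaller degree, and earlier blocks weigh much less. So the monomials with all
  exponents below \<open>D\<^sub>s\<close> span the functions on \<open>S \<inter> H\<close>, which has at most
  \<open>\<Prod>\<^sub>s D\<^sub>s \<le> d\<^sub>1\<^sup>k\<close> points.

  Size. If \<open>k\<close> degrees are coprime to \<open>|\<bbbF>| - 1\<close>, the other \<open>m - k\<close> variables of a block are free and
  determine these \<open>k\<close>. In general, the zeros of one block are counted by a sum over \<open>u \<in> \<bbbF>\<^sup>k\<close> of products
  of power sums \<open>\<Sum>\<^sub>x \<psi> (c x ^ e)\<close> with \<open>c\<close> a coordinate of \<open>u A\<close>. For \<open>u \<noteq> 0\<close> fewer than \<open>k\<close> of these
  coordinates vanish, and for \<open>c \<noteq> 0\<close> the power sum is at most \<open>e |\<bbbF>|\<^sup>1\<^sup>/\<^sup>2\<close>.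
\<close>

subsection \<open>Zero sets with a weight-decreasing reduction\<close>

lemma card_finite_field_gt_1: "CARD('a::{field,finite}) > 1"
  using card_mono[of UNIV "{0::'a, 1}"] by simp

text \<open>Polynomial functions in the coordinates from \<open>J\<close> of weighted degree at most
  \<open>c\<close>, where \<open>x s\<close> has weight \<open>w s\<close>. Adding one monomial at a
  time makes closure under sums and products an induction over monomials.\<close>

inductive_set weighted_polys :: "'i set \<Rightarrow> ('i \<Rightarrow> nat) \<Rightarrow> nat \<Rightarrow> (('i \<Rightarrow> 'a::comm_ring_1) \<Rightarrow> 'a) set"
  for J w c where
    zero: "(\<lambda>_. 0) \<in> weighted_polys J w c"
  | add_monom: "f \<in> weighted_polys J w c \<Longrightarrow> (\<Sum>s\<in>J. w s * a s) \<le> c \<Longrightarrow>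
      (\<lambda>x. f x + b * (\<Prod>s\<in>J. x s ^ a s)) \<in> weighted_polys J w c"

lemma weighted_polys_mono:
  "f \<in> weighted_polys J w c \<Longrightarrow> c \<le> c' \<Longrightarrow> f \<in> weighted_polys J w c'"
proof (induction rule: weighted_polys.induct)
  case zero
  show ?case by (rule weighted_polys.zero)
next
  case (add_monom f a b)
  then show ?case by (intro weighted_polys.add_monom) auto
qed

lemma weighted_polys_add:
  assumes "g \<in> weighted_polys J w c" and "f \<in> weighted_polys J w c"
  shows "(\<lambda>x. f x + g x) \<in> weighted_polys J w c"
  using assms(1)
proof (induction rule: weighted_polys.induct)
  case zero
  show ?case using assms(2) by simp
next
  case (add_monom g a b)
  from weighted_polys.add_monom[OF add_monom.IH add_monom.hyps(2), of b]
  show ?case by (simp add: add.assoc)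
qed

lemma weighted_polys_monom:
  "(\<Sum>s\<in>J. w s * a s) \<le> c \<Longrightarrow> (\<lambda>x. b * (\<Prod>s\<in>J. x s ^ a s)) \<in> weighted_polys J w c"
  using weighted_polys.add_monom[OF weighted_polys.zero, where w = w and J = J and c = c and a = a and b = b] by simp

lemma weighted_polys_const: "(\<lambda>_. b) \<in> weighted_polys J w c"
  using weighted_polys_monom[where w = w and J = J and c = c and a = "\<lambda>_. 0" and b = b] by simp

lemma weighted_polys_sum:
  assumes "\<And>t. t \<in> T \<Longrightarrow> f t \<in> weighted_polys J w c"
  shows "(\<lambda>x. \<Sum>t\<in>T. f t x) \<in> weighted_polys J w c"
  using assms
proof (induction T rule: infinite_finite_induct)
  case (insert t T)
  then show ?case
    using weighted_polys_add[of "\<lambda>x. \<Sum>t\<in>T. f t x" J w c "f t"] by simp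
qed (simp_all add: weighted_polys.zero)

lemma weighted_polys_mult_monom:
  assumes "f \<in> weighted_polys J w c" and "(\<Sum>s\<in>J. w s * a s) \<le> c'"
  shows "(\<lambda>x. f x * (b * (\<Prod>s\<in>J. x s ^ a s))) \<in> weighted_polys J w (c + c')"
  using assms(1)
proof (induction rule: weighted_polys.induct)
  case zero
  show ?case by (simp add: weighted_polys.zero)
next
  case (add_monom f a' b')
  have "(\<Sum>s\<in>J. w s * (a' s + a s)) \<le> c + c'"
    using add_monom.hyps(2) assms(2) by (simp add: distrib_left sum.distrib)
  from weighted_polys.add_monom[OF add_monom.IH this, of "b' * b"]
  show ?case
    by (simp add: power_add prod.distrib algebra_simps)
qed

lemma weighted_polys_mult:
  assumes "g \<in> weighted_polys J w c'" and "f \<in> weighted_polys J w c"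
  shows "(\<lambda>x. f x * g x) \<in> weighted_polys J w (c + c')"
  using assms(1)
proof (induction rule: weighted_polys.induct)
  case zero
  show ?case by (simp add: weighted_polys.zero)
next
  case (add_monom g a b)
  from weighted_polys_add[OF weighted_polys_mult_monom[OF assms(2) add_monom.hyps(2), of b] add_monom.IH]
  show ?case by (simp add: distrib_left)
qed

lemma weighted_polys_power:
  assumes "f \<in> weighted_polys J w c"
  shows "(\<lambda>x. f x ^ e) \<in> weighted_polys J w (e * c)"
proof (induction e)
  case 0
  show ?case using weighted_polys_const[of 1] by simp
next
  case (Suc e)
  from weighted_polys_mult[OF Suc assms] show ?case by (simp add: mult.commute add.commute)
qed

lemma weighted_polys_var:
  assumes "finite J" "s \<in> J" "w s \<le> c"
  shows "(\<lambda>x. x s :: 'a::comm_ring_1) \<in> weighted_polys J w c"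
proof -
  have "(\<Sum>s'\<in>J. w s' * (if s' = s then 1 else 0)) = (\<Sum>s'\<in>J. if s' = s then w s' else 0)"
    by (intro sum.cong) auto
  then have "(\<Sum>s'\<in>J. w s' * (if s' = s then 1 else 0)) \<le> c"
    using assms by simp
  from weighted_polys_monom[OF this, of 1]
  have "(\<lambda>x :: _ \<Rightarrow> 'a. (\<Prod>s'\<in>J. x s' ^ (if s' = s then 1 else 0))) \<in> weighted_polys J w c" by simp
  moreover have "(\<Prod>s'\<in>J. x s' ^ (if s' = s then 1 else 0)) = x s" for x :: "_ \<Rightarrow> 'a"
  proof -
    have "(\<Prod>s'\<in>J. x s' ^ (if s' = s then 1 else 0)) = (\<Prod>s'\<in>J. if s' = s then x s' else 1)"
      by (intro prod.cong) auto
    then show ?thesis using assms by simp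
  qed
  ultimately show ?thesis by (simp only:)
qed

text \<open>Lagrange interpolation: each \<open>y\<close> in \<open>Y\<close> contributes a factor
  \<open>(x s - y s) / (z s - y s)\<close> for some coordinate \<open>s\<close> in which it differs
  from \<open>z\<close>.\<close>

lemma weighted_polys_separating:
  fixes z :: "'i \<Rightarrow> 'a::field"
  assumes "finite J" "finite Y" and "\<And>y. y \<in> Y \<Longrightarrow> \<exists>s\<in>J. y s \<noteq> z s"
  shows "\<exists>c. \<exists>f\<in>weighted_polys J w c. f z = 1 \<and> (\<forall>y\<in>Y. f y = 0)"
  using assms(2,3)
proof (induction Y rule: finite_induct)
  case empty
  show ?case using weighted_polys_const[of 1 J w 0] by auto
next
  case (insert y Y)
  then obtain c f where f: "f \<in> weighted_polys J w c" "f z = 1" "\<forall>y\<in>Y. f y = 0" by blast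
  obtain s where s: "s \<in> J" "y s \<noteq> z s" using insert.prems by blast
  define b where "b = inverse (z s - y s)"
  have "(\<lambda>x. x s) \<in> weighted_polys J w (w s)" using assms(1) s(1) by (rule weighted_polys_var) simp
  from weighted_polys_add[OF weighted_polys_const[of "- y s"] this]
  have "(\<lambda>x. x s + - y s) \<in> weighted_polys J w (w s)" .
  from weighted_polys_mult[OF weighted_polys_const[of b J w 0] this]
  have "(\<lambda>x. (x s + - y s) * b) \<in> weighted_polys J w (w s)" by simp
  from weighted_polys_mult[OF this f(1)]
  have "(\<lambda>x. f x * ((x s + - y s) * b)) \<in> weighted_polys J w (c + w s)" .
  moreover have "(z s - y s) * b = 1" using s by (simp add: b_def)
  ultimately show ?case using f(2,3)
    by (intro exI[of _ "c + w s"] bexI[of _ "\<lambda>x. f x * ((x s + - y s) * b)"]) auto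
qed

text \<open>A polynomial with coefficients \<open>g\<close> whose exponents lie in the box below
  \<open>D\<close>. Extensional exponent families are used so that a finite \<open>J\<close> gives
  exactly \<open>\<Prod>s\<in>J. D s\<close> of them.\<close>

definition reduced_combination ::
    "'i set \<Rightarrow> ('i \<Rightarrow> nat) \<Rightarrow> (('i \<Rightarrow> nat) \<Rightarrow> 'a::comm_ring_1) \<Rightarrow> ('i \<Rightarrow> 'a) \<Rightarrow> 'a" where
  "reduced_combination J D g z =
     (\<Sum>a\<in>(\<Pi>\<^sub>E s\<in>J. {..<D s}). g a * (\<Prod>s\<in>J. z s ^ a s))"

lemma reduced_monom:
  fixes b :: "'a::comm_ring_1"
  assumes "finite J" "\<And>s. s \<in> J \<Longrightarrow> a s < D s"
  shows "\<exists>g. \<forall>z. b * (\<Prod>s\<in>J. z s ^ a s) = reduced_combination J D g z"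
proof -
  define a' where "a' = restrict a J"
  have a': "a' \<in> (\<Pi>\<^sub>E s\<in>J. {..<D s})" using assms(2) by (auto simp: a'_def)
  have fin: "finite (\<Pi>\<^sub>E s\<in>J. {..<D s})" using assms(1) by (intro finite_PiE) auto
  have "b * (\<Prod>s\<in>J. z s ^ a s) = reduced_combination J D (\<lambda>x. if x = a' then b else 0) z" for z
  proof -
    have "reduced_combination J D (\<lambda>x. if x = a' then b else 0) z
        = (\<Sum>x\<in>(\<Pi>\<^sub>E s\<in>J. {..<D s}). if x = a' then b * (\<Prod>s\<in>J. z s ^ x s) else 0)"
      unfolding reduced_combination_def by (intro sum.cong) auto
    also have "\<dots> = b * (\<Prod>s\<in>J. z s ^ a' s)" using a' fin by simp
    also have "\<dots> = b * (\<Prod>s\<in>J. z s ^ a s)" by (simp add: a'_def)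
    finally show ?thesis by simp
  qed
  then show ?thesis by blast
qed

text \<open>On \<open>Z\<close> the power \<open>z s ^ D s\<close> equals some \<open>h\<close> of
  weight strictly below \<open>w s * D s\<close>. Rewriting thus lowers the weight of any monomial
  outside the box, and strong induction on the weight bound terminates, as in division by a Groebner
  basis with leading terms \<open>z s ^ D s\<close>.\<close>

lemma weighted_polys_reduce:
  fixes Z :: "('i \<Rightarrow> 'a::comm_ring_1) set"
  assumes J: "finite J"
    and red: "\<And>s. s \<in> J \<Longrightarrow> \<exists>c<w s * D s. \<exists>h\<in>weighted_polys J w c. \<forall>z\<in>Z. z s ^ D s = h z"
  shows "f \<in> weighted_polys J w c \<Longrightarrow> \<exists>g. \<forall>z\<in>Z. f z = reduced_combination J D g z"
proof (induction c arbitrary: f rule: less_induct)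
  case (less c)
  have monom: "\<exists>g. \<forall>z\<in>Z. b * (\<Prod>s\<in>J. z s ^ a s) = reduced_combination J D g z"
    if a: "(\<Sum>s\<in>J. w s * a s) \<le> c" for a b
  proof (cases "\<forall>s\<in>J. a s < D s")
    case True
    then show ?thesis using reduced_monom[OF J, of a D b] by blast
  next
    case False
    then obtain s where s: "s \<in> J" "D s \<le> a s" by (auto simp: not_less)
    obtain c' h where h: "c' < w s * D s" "h \<in> weighted_polys J w c'" "\<And>z. z \<in> Z \<Longrightarrow> z s ^ D s = h z"
      using red[OF s(1)] by blast
    \<comment> \<open>\<open>a'\<close> strips one factor \<open>z s ^ D s\<close>; with
      \<open>h\<close> in its place the weight is at most
      \<open>c' + (\<Sum>s\<in>J. w s * a' s)\<close>, which is below \<open>c\<close>.\<close>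
    define a' where "a' = a(s := a s - D s)"
    have split_w: "(\<Sum>s\<in>J. w s * a s) = (\<Sum>s\<in>J. w s * a' s) + w s * D s"
      using J s by (simp add: a'_def sum.remove[of J s] flip: distrib_left)
    have split: "(\<Prod>s\<in>J. z s ^ a s) = z s ^ D s * (\<Prod>s\<in>J. z s ^ a' s)" for z :: "'i \<Rightarrow> 'a"
      using J s by (simp add: a'_def prod.remove[of J s] flip: mult.assoc power_add)
    from weighted_polys_mult_monom[OF h(2) order.refl, where a = a' and b = b]
    obtain g where "\<forall>z\<in>Z. h z * (b * (\<Prod>s\<in>J. z s ^ a' s)) = reduced_combination J D g z"
      using less.IH[of "c' + (\<Sum>s\<in>J. w s * a' s)"] h(1) a split_w by auto
    then show ?thesis using h(3) by (intro exI[of _ g]) (auto simp: split mult_ac)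
  qed
  from less.prems show ?case
  proof (induction rule: weighted_polys.induct)
    case zero
    show ?case by (intro exI[of _ "\<lambda>_. 0"]) (simp add: reduced_combination_def)
  next
    case (add_monom f a b)
    then obtain g g' where "\<forall>z\<in>Z. f z = reduced_combination J D g z"
      "\<forall>z\<in>Z. b * (\<Prod>s\<in>J. z s ^ a s) = reduced_combination J D g' z"
      using monom by metis
    then show ?case
      by (intro exI[of _ "\<lambda>x. g x + g' x"])
        (simp add: reduced_combination_def distrib_right sum.distrib)
  qed
qed

text \<open>The reduced monomials span all functions \<open>Z \<rightarrow> \<bbbF>\<close>; comparing the number of coefficient
  families with the number of functions replaces Bezout's theorem.\<close>

lemma card_le_prod_degrees:
  fixes Z :: "('i \<Rightarrow> 'a::{field,finite}) set"
  assumes J: "finite J" and Z: "finite Z"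
    and sep: "\<And>z z'. z \<in> Z \<Longrightarrow> z' \<in> Z \<Longrightarrow> z \<noteq> z' \<Longrightarrow> \<exists>s\<in>J. z s \<noteq> z' s"
    and red: "\<And>s. s \<in> J \<Longrightarrow> \<exists>c<w s * D s. \<exists>h\<in>weighted_polys J w c. \<forall>z\<in>Z. z s ^ D s = h z"
  shows "card Z \<le> (\<Prod>s\<in>J. D s)"
proof -
  define B where "B = (\<Pi>\<^sub>E s\<in>J. {..<D s})"
  have B: "finite B" "card B = (\<Prod>s\<in>J. D s)"
    unfolding B_def using J by (auto intro!: finite_PiE simp: card_PiE)
  \<comment> \<open>The indicator of a point on \<open>Z\<close> comes from an interpolating
    polynomial, which then reduces.\<close>
  have "\<exists>g. \<forall>y\<in>Z. reduced_combination J D g y = (if y = z then 1 else 0)" if "z \<in> Z" for z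
  proof -
    have "\<exists>c. \<exists>f\<in>weighted_polys J w c. f z = 1 \<and> (\<forall>y\<in>Z - {z}. f y = 0)"
      using that Z by (intro weighted_polys_separating J) (auto dest: sep)
    then obtain c f where f: "f \<in> weighted_polys J w c" "f z = 1" "\<forall>y\<in>Z - {z}. f y = 0"
      by blast
    obtain g where "\<forall>y\<in>Z. f y = reduced_combination J D g y"
      using weighted_polys_reduce[OF J red f(1)] by blast
    with f(2,3) show ?thesis by (intro exI[of _ g]) auto
  qed
  then obtain G where G: "\<And>z y. z \<in> Z \<Longrightarrow> y \<in> Z \<Longrightarrow> reduced_combination J D (G z) y = (if y = z then 1 else 0)"
    by metis
  have "(Z \<rightarrow>\<^sub>E UNIV) \<subseteq> (\<lambda>g. \<lambda>y\<in>Z. reduced_combination J D g y) ` (B \<rightarrow>\<^sub>E UNIV)"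
  proof
    fix \<phi> :: "('i \<Rightarrow> 'a) \<Rightarrow> 'a" assume \<phi>: "\<phi> \<in> Z \<rightarrow>\<^sub>E UNIV"
    define g where "g = (\<lambda>a\<in>B. \<Sum>z\<in>Z. \<phi> z * G z a)"
    have "reduced_combination J D g y = \<phi> y" if y: "y \<in> Z" for y
    proof -
      have "reduced_combination J D g y = (\<Sum>a\<in>B. \<Sum>z\<in>Z. \<phi> z * (G z a * (\<Prod>s\<in>J. y s ^ a s)))"
        unfolding reduced_combination_def B_def[symmetric]
        by (intro sum.cong) (auto simp: g_def sum_distrib_right mult.assoc)
      also have "\<dots> = (\<Sum>z\<in>Z. \<phi> z * reduced_combination J D (G z) y)"
        unfolding reduced_combination_def B_def[symmetric]
        by (subst sum.swap) (simp add: sum_distrib_left)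
      also have "\<dots> = (\<Sum>z\<in>Z. if y = z then \<phi> z else 0)"
        using y by (intro sum.cong) (auto simp: G)
      finally show ?thesis using y Z by simp
    qed
    then have "\<phi> = (\<lambda>y\<in>Z. reduced_combination J D g y)"
      using \<phi> by (auto simp: fun_eq_iff PiE_def extensional_def)
    moreover have "g \<in> B \<rightarrow>\<^sub>E UNIV" by (simp add: g_def)
    ultimately show "\<phi> \<in> (\<lambda>g. \<lambda>y\<in>Z. reduced_combination J D g y) ` (B \<rightarrow>\<^sub>E UNIV)" by blast
  qed
  from surj_card_le[OF _ this] have "CARD('a) ^ card Z \<le> CARD('a) ^ card B"
    using B(1) Z by (simp add: card_PiE finite_PiE)
  then show ?thesis using B(2) card_finite_field_gt_1[where 'a = 'a] by simp
qed

subsection \<open>Minors, subspaces and pivots\<close>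

text \<open>Strong regularity makes the minor on the first \<open>card J\<close> rows and the
  columns \<open>J\<close> invertible; \<open>C\<close> is its inverse, indexed by the elements of
  \<open>J\<close>. The left-inverse identity isolates single variables of \<open>J\<close>; the
  right-inverse identity verifies solutions and shows that a row combination vanishing on
  \<open>k\<close> columns is trivial.\<close>

lemma ex_inverse_of_minor:
  fixes A :: "'a::field mat"
  assumes A: "A \<in> carrier_mat k m" and reg: "strongly_regular A"
    and J: "J \<subseteq> {..<m}" "card J \<le> k"
  obtains C :: "nat \<Rightarrow> nat \<Rightarrow> 'a"
  where "\<And>p j. p \<in> J \<Longrightarrow> j \<in> J \<Longrightarrow> (\<Sum>i<card J. C p i * A $$ (i, j)) = (if p = j then 1 else 0)"
    and "\<And>i i'. i < card J \<Longrightarrow> i' < card J \<Longrightarrow>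
      (\<Sum>j\<in>J. A $$ (i, j) * C j i') = (if i = i' then 1 else 0)"
proof (cases "card J = 0")
  case True
  then have "J = {}" using J finite_subset[of J "{..<m}"] by auto
  then show ?thesis using that[of "\<lambda>_ _. 0"] by simp
next
  case False
  define r where "r = card J"
  define B where "B = submatrix A {..<r} J"
  define e where "e j = card {a \<in> J. a < j}" for j
  have dims: "dim_row A = k" "dim_col A = m" using A by auto
  have finJ: "finite J" using J(1) by (rule finite_subset) simp
  have e: "e j < r" if "j \<in> J" for j
    unfolding e_def r_def using that finJ by (intro psubset_card_mono) auto
  have pick_e: "pick J (e j) = j" if "j \<in> J" for j
    unfolding e_def using that by (rule pick_card_in_set)
  have bij: "bij_betw (pick J) {..<r} J"
    unfolding r_def using e pick_e
    by (intro bij_betw_byWitness[where f' = e])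
      (auto simp: r_def e_def card_pick_le pick_in_set_le image_subset_iff)
  have rows: "{i. i < dim_row A \<and> i \<in> {..<r}} = {..<r}" using J(2) dims by (auto simp: r_def)
  have cols: "{j. j < dim_col A \<and> j \<in> J} = J" using J(1) dims by auto
  have B: "B \<in> carrier_mat r r"
    by (rule carrier_matI) (simp_all only: B_def dim_submatrix rows cols card_lessThan flip: r_def)
  have pick_id: "pick {..<r} i = i" if "i < r" for i
  proof -
    have "{a \<in> {..<r}. a < i} = {..<i}" using that by auto
    then show ?thesis using pick_card_in_set[of i "{..<r}"] that by simp
  qed
  have B_eq: "B $$ (i, l) = A $$ (i, pick J l)" if "i < r" "l < r" for i l
  proof -
    have "i < card {i. i < dim_row A \<and> i \<in> {..<r}}" "l < card {j. j < dim_col A \<and> j \<in> J}"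
      using that unfolding rows cols by (simp_all add: r_def)
    from submatrix_index[OF this] show ?thesis using pick_id[OF that(1)] by (simp add: B_def)
  qed
  have "det B \<noteq> 0"
    using reg False J dims unfolding strongly_regular_def B_def
    by (auto simp: r_def)
  from det_non_zero_imp_unit[OF B this, of "()"] obtain D where D: "D \<in> carrier_mat r r"
    "D * B = 1\<^sub>m r" "B * D = 1\<^sub>m r"
    by (auto simp: Units_def ring_mat_def)
  define C where "C p i = D $$ (e p, i)" for p i
  have DB: "(\<Sum>i<r. D $$ (p, i) * B $$ (i, j)) = (if p = j then 1 else 0)" if "p < r" "j < r" for p j
  proof -
    have "(D * B) $$ (p, j) = (\<Sum>i<r. D $$ (p, i) * B $$ (i, j))"
      using that D(1) B by (simp add: scalar_prod_def atLeast0LessThan)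
    then show ?thesis using D(2) that by simp
  qed
  have BD: "(\<Sum>i<r. B $$ (p, i) * D $$ (i, j)) = (if p = j then 1 else 0)" if "p < r" "j < r" for p j
  proof -
    have "(B * D) $$ (p, j) = (\<Sum>i<r. B $$ (p, i) * D $$ (i, j))"
      using that D(1) B by (simp add: scalar_prod_def atLeast0LessThan)
    then show ?thesis using D(3) that by simp
  qed
  show ?thesis
  proof (rule that[of C])
    fix p j assume p: "p \<in> J" and j: "j \<in> J"
    have "(\<Sum>i<r. C p i * A $$ (i, j)) = (\<Sum>i<r. D $$ (e p, i) * B $$ (i, e j))"
      using e[OF j] by (intro sum.cong) (auto simp: C_def B_eq pick_e[OF j])
    also have "\<dots> = (if e p = e j then 1 else 0)" using p j by (intro DB e)
    also have "\<dots> = (if p = j then 1 else 0)" using pick_e p j by metis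
    finally show "(\<Sum>i<card J. C p i * A $$ (i, j)) = (if p = j then 1 else 0)"
      by (simp add: r_def)
  next
    fix i i' assume i: "i < card J" and i': "i' < card J"
    have "(\<Sum>j\<in>J. A $$ (i, j) * C j i') = (\<Sum>l<r. A $$ (i, pick J l) * C (pick J l) i')"
      by (rule sum.reindex_bij_betw[OF bij, symmetric])
    also have "\<dots> = (\<Sum>l<r. B $$ (i, l) * D $$ (l, i'))"
      using i by (intro sum.cong) (auto simp: C_def B_eq e_def r_def card_pick_le)
    finally show "(\<Sum>j\<in>J. A $$ (i, j) * C j i') = (if i = i' then 1 else 0)"
      using BD i i' by (simp add: r_def)
  qed
qed

text \<open>\<open>W\<close> is finite and generates itself, hence has a finite basis; coefficient
  families on that basis cover \<open>W\<close>.\<close>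

lemma (in vec_space) card_subspace_le:
  assumes W: "VectorSpace.subspace class_ring W V" and fin: "finite W"
    and fin_field: "finite (UNIV :: 'a set)"
  shows "card W \<le> CARD('a) ^ vectorspace.dim class_ring (V\<lparr>carrier := W\<rparr>)"
proof -
  interpret W: vectorspace class_ring "V\<lparr>carrier := W\<rparr>"
    using subspace_is_vs[OF W] .
  have sub: "submodule class_ring W V" using W by (simp add: subspace_def)
  then have W_sub: "W \<subseteq> carrier_vec n" by (auto simp: submodule_def)
  have "W.gen_set W"
  proof -
    have "W \<subseteq> W.span W" using W.in_own_span[of W] by simp
    moreover have "W.span W \<subseteq> W" using W.span_is_subset2[of W] by simp
    ultimately show ?thesis by simp
  qed
  then have "W.fin_dim" using fin unfolding W.fin_dim_def by auto
  then obtain X where X: "finite X" "W.basis X" using W.finite_basis_exists by blast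
  have X_sub: "X \<subseteq> W" and X_span: "W.span X = W" using X(2) by (auto simp: W.basis_def)
  have dim: "card X = W.dim" using X W.dim_basis by simp
  have "W \<subseteq> (\<lambda>a. lincomb a X) ` (X \<rightarrow>\<^sub>E UNIV)"
  proof
    fix v assume "v \<in> W"
    then have "v \<in> span X" using X_span span_li_not_depend(1)[OF X_sub sub] by simp
    then obtain a where "v = lincomb a X"
      using finite_span[OF X(1)] X_sub W_sub by auto
    also have "\<dots> = lincomb (restrict a X) X"
      unfolding lincomb_def by (rule M.finsum_cong') (use X_sub W_sub in auto)
    finally show "v \<in> (\<lambda>a. lincomb a X) ` (X \<rightarrow>\<^sub>E UNIV)"
      by (intro image_eqI[where x = "restrict a X"]) simp_all
  qed
  moreover have "finite (X \<rightarrow>\<^sub>E (UNIV :: 'a set))" using X(1) fin_field by (simp add: finite_PiE)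
  ultimately have "card W \<le> card (X \<rightarrow>\<^sub>E (UNIV :: 'a set))" by (metis surj_card_le)
  then have "card W \<le> CARD('a) ^ card X" using X(1) by (simp add: card_PiE)
  then show ?thesis using dim by simp
qed

lemma bij_betw_carrier_vec:
  "bij_betw (\<lambda>x. \<lambda>j\<in>{..<n}. x $ j) (carrier_vec n) ({..<n} \<rightarrow>\<^sub>E (UNIV :: 'a set))"
  by (rule bij_betw_byWitness[where f' = "vec n"]) (auto simp: fun_eq_iff extensional_def PiE_def)

lemma finite_carrier_vec: "finite (carrier_vec n :: 'a::finite vec set)"
  using bij_betw_finite[OF bij_betw_carrier_vec[of n, where 'a = 'a]] by (simp add: finite_PiE)

text \<open>Reduced row echelon form: \<open>J\<close> collects the positions of first nonzero
  entries of vectors of \<open>W\<close>, and \<open>U s\<close> is the basis vector with pivot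
  \<open>s\<close>.\<close>

lemma echelon_basis:
  fixes W :: "'a::field vec set"
  assumes sub: "W \<subseteq> carrier_vec n" and zero: "0\<^sub>v n \<in> W"
    and add: "\<And>v w. v \<in> W \<Longrightarrow> w \<in> W \<Longrightarrow> v + w \<in> W"
    and smult: "\<And>a w. w \<in> W \<Longrightarrow> a \<cdot>\<^sub>v w \<in> W"
  obtains J U where "J \<subseteq> {..<n}"
    and "\<And>T c. T \<subseteq> J \<Longrightarrow> \<exists>v\<in>W. \<forall>j<n. v $ j = (\<Sum>s\<in>T. c s * U s $ j)"
    and "\<And>s s'. s \<in> J \<Longrightarrow> s' \<in> J \<Longrightarrow> U s $ s' = (if s' = s then 1 else 0)"
    and "\<And>s j. s \<in> J \<Longrightarrow> j < s \<Longrightarrow> U s $ j = 0"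
    and "\<And>w j. w \<in> W \<Longrightarrow> j < n \<Longrightarrow> w $ j = (\<Sum>s\<in>J. w $ s * U s $ j)"
proof -
  define J where "J = {j. j < n \<and> (\<exists>w\<in>W. w $ j \<noteq> 0 \<and> (\<forall>i<j. w $ i = 0))}"
  have J: "J \<subseteq> {..<n}" "finite J" by (auto simp: J_def)
  have dim: "dim_vec w = n" if "w \<in> W" for w using that sub by auto
  have first_nonzero: "\<exists>s\<in>J. s \<le> j \<and> w $ s \<noteq> 0" if "w \<in> W" "j < n" "w $ j \<noteq> 0" for w j
  proof -
    define s where "s = (LEAST i. w $ i \<noteq> 0)"
    have "w $ s \<noteq> 0" "s \<le> j" unfolding s_def using that(3) by (rule LeastI, rule Least_le)
    moreover have "\<forall>i<s. w $ i = 0" unfolding s_def using not_less_Least by blast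
    ultimately show ?thesis using that(1,2) by (intro bexI[of _ s]) (auto simp: J_def)
  qed
  \<comment> \<open>Gauss-Jordan elimination, column by column: a vector with leading position
    \<open>j\<close> is scaled to \<open>v\<close>, and multiples of \<open>v\<close> clear column
    \<open>j\<close> of the earlier \<open>U s\<close>. As \<open>v\<close> vanishes left of
    \<open>j\<close>, the earlier pivot columns stay intact.\<close>
  have "\<exists>U. \<forall>s\<in>J. s < j \<longrightarrow> U s \<in> W \<and> (\<forall>s'\<in>J. s' < j \<longrightarrow> U s $ s' = (if s' = s then 1 else 0))"
    if "j \<le> n" for j
    using that
  proof (induction j)
    case 0
    then show ?case by simp
  next
    case (Suc j)
    then obtain U where U: "\<And>s. s \<in> J \<Longrightarrow> s < j \<Longrightarrow> U s \<in> W"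
      "\<And>s s'. s \<in> J \<Longrightarrow> s < j \<Longrightarrow> s' \<in> J \<Longrightarrow> s' < j \<Longrightarrow> U s $ s' = (if s' = s then 1 else 0)"
      by (metis Suc_leD)
    show ?case
    proof (cases "j \<in> J")
      case False
      then show ?thesis using U by (intro exI[of _ U]) (metis less_SucE)
    next
      case True
      then obtain w where w: "w \<in> W" "w $ j \<noteq> 0" "\<And>i. i < j \<Longrightarrow> w $ i = 0" by (auto simp: J_def)
      define v where "v = inverse (w $ j) \<cdot>\<^sub>v w"
      have v: "v \<in> W" "v $ j = 1" "\<And>i. i < j \<Longrightarrow> v $ i = 0"
        using w smult dim[OF w(1)] Suc.prems by (auto simp: v_def)
      define U' where "U' s = (if s = j then v else U s + (- (U s $ j)) \<cdot>\<^sub>v v)" for s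
      have W': "U' s \<in> W" if "s \<in> J" "s < Suc j" for s
        using that v(1) U(1) by (auto simp: U'_def less_Suc_eq intro!: add smult)
      have "U' s $ s' = (if s' = s then 1 else 0)" if "s \<in> J" "s' \<in> J" "s < Suc j" "s' < Suc j" for s s'
      proof (cases "s = j")
        case True
        then show ?thesis using v that(4) by (auto simp: U'_def less_Suc_eq)
      next
        case False
        then have "U' s $ s' = U s $ s' - U s $ j * v $ s'"
          using that dim[OF v(1)] Suc.prems by (simp add: U'_def)
        then show ?thesis using False that v U(2) by (auto simp: less_Suc_eq)
      qed
      with W' show ?thesis by blast
    qed
  qed
  from this[of n] J obtain U where U: "\<And>s. s \<in> J \<Longrightarrow> U s \<in> W"
    "\<And>s s'. s \<in> J \<Longrightarrow> s' \<in> J \<Longrightarrow> U s $ s' = (if s' = s then 1 else 0)"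
    by (metis lessThan_iff order_refl subsetD)
  have comb: "\<exists>v\<in>W. \<forall>j<n. v $ j = (\<Sum>s\<in>T. c s * U s $ j)" if "T \<subseteq> J" for T c
  proof -
    have "finite T" using J(2) that by (rule rev_finite_subset)
    then show ?thesis using that
    proof (induction T rule: finite_induct)
      case empty
      show ?case using zero by (intro bexI[of _ "0\<^sub>v n"]) auto
    next
      case (insert s T)
      then obtain v where v: "v \<in> W" "\<forall>j<n. v $ j = (\<Sum>s\<in>T. c s * U s $ j)" by blast
      have "U s \<in> W" using insert.prems U by blast
      with v insert dim show ?case
        by (intro bexI[of _ "c s \<cdot>\<^sub>v U s + v"]) (auto intro!: add smult)
    qed
  qed
  show ?thesis
  proof (rule that[OF J(1) comb U(2)])
    fix s j assume s: "s \<in> J" "j < s"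
    \<comment> \<open>Otherwise \<open>U s\<close> would be nonzero at some pivot left of
      \<open>s\<close>.\<close>
    show "U s $ j = 0"
    proof (rule ccontr)
      assume "U s $ j \<noteq> 0"
      then obtain s' where "s' \<in> J" "s' \<le> j" "U s $ s' \<noteq> 0"
        using first_nonzero[OF U(1)[OF s(1)], of j] s J(1) by (meson lessThan_iff less_trans subsetD)
      then show False using U(2)[OF s(1), of s'] s(2) by (auto split: if_splits)
    qed
  next
    fix w j assume w: "w \<in> W" and j: "j < n"
    obtain v where v: "v \<in> W" "\<And>j. j < n \<Longrightarrow> v $ j = (\<Sum>s\<in>J. w $ s * U s $ j)"
      using comb[OF order.refl, of "($) w"] by blast
    \<comment> \<open>\<open>u\<close> vanishes at every pivot, so it has no leading entry and must
      be zero.\<close>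
    define u where "u = w + (-1) \<cdot>\<^sub>v v"
    have u: "u \<in> W" "\<And>i. i < n \<Longrightarrow> u $ i = w $ i - v $ i"
      using w v(1) dim by (auto simp: u_def intro!: add smult)
    have "v $ s = w $ s" if "s \<in> J" for s
    proof -
      have "v $ s = (\<Sum>s'\<in>J. w $ s' * U s' $ s)" using v(2) that J by auto
      also have "\<dots> = (\<Sum>s'\<in>J. if s' = s then w $ s' else 0)"
        using that by (intro sum.cong) (auto simp: U(2))
      finally show ?thesis using that J by simp
    qed
    then have "u $ j = 0" using first_nonzero[OF u(1) j] u(2) J by force
    then show "w $ j = (\<Sum>s\<in>J. w $ s * U s $ j)" using u(2) v(2) j by simp
  qed auto
qed

text \<open>The base point of \<open>H\<close> goes into \<open>b j\<close>, and the zeros of the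
  echelon vectors left of their pivots restrict the sum to \<open>s < j\<close>. The bound on
  \<open>card J\<close> is a count: \<open>W\<close> restricts onto all functions on
  \<open>J\<close>, yet has at most \<open>CARD('a) ^ k\<close> elements.\<close>

lemma affine_subspace_pivots:
  fixes H :: "'a::{field,finite} vec set"
  assumes "affine_subspace n k H"
  obtains J b U where "J \<subseteq> {..<n}" "card J \<le> k" "H \<subseteq> carrier_vec n"
    "\<And>j. j < n \<Longrightarrow> j \<notin> J \<Longrightarrow> \<forall>x\<in>H. x $ j = b j + (\<Sum>s\<in>{s\<in>J. s < j}. U j s * x $ s)"
proof -
  interpret vec_space "TYPE('a)" n .
  from assms obtain p W where p: "p \<in> carrier_vec n"
    and W: "VectorSpace.subspace class_ring W V"
    and dim: "vectorspace.dim class_ring (V\<lparr>carrier := W\<rparr>) = k" and H: "H = (\<lambda>w. p + w) ` W"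
    unfolding affine_subspace_def by auto
  have "submodule class_ring W V" using W by (simp add: subspace_def)
  then have sub: "W \<subseteq> carrier_vec n" and zero: "0\<^sub>v n \<in> W"
    and add: "\<And>v w. v \<in> W \<Longrightarrow> w \<in> W \<Longrightarrow> v + w \<in> W"
    and smult: "\<And>a w. w \<in> W \<Longrightarrow> a \<cdot>\<^sub>v w \<in> W"
    by (auto simp: submodule_def)
  show ?thesis
  proof (rule echelon_basis[OF sub zero add smult])
    fix J :: "nat set" and U :: "nat \<Rightarrow> 'a vec"
    assume J: "J \<subseteq> {..<n}"
      and comb: "\<And>T c. T \<subseteq> J \<Longrightarrow> \<exists>v\<in>W. \<forall>j<n. v $ j = (\<Sum>s\<in>T. c s * U s $ j)"
      and delta: "\<And>s s'. s \<in> J \<Longrightarrow> s' \<in> J \<Longrightarrow> U s $ s' = (if s' = s then 1 else 0)"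
      and lead: "\<And>s j. s \<in> J \<Longrightarrow> j < s \<Longrightarrow> U s $ j = 0"
      and expand: "\<And>w j. w \<in> W \<Longrightarrow> j < n \<Longrightarrow> w $ j = (\<Sum>s\<in>J. w $ s * U s $ j)"
    have finJ: "finite J" using J by (rule finite_subset) simp
    have finW: "finite W" using sub finite_carrier_vec by (rule finite_subset)
    have "(J \<rightarrow>\<^sub>E UNIV) \<subseteq> (\<lambda>w. \<lambda>s\<in>J. w $ s) ` W"
    proof
      fix c :: "nat \<Rightarrow> 'a" assume c: "c \<in> J \<rightarrow>\<^sub>E UNIV"
      obtain v where v: "v \<in> W" "\<And>j. j < n \<Longrightarrow> v $ j = (\<Sum>s\<in>J. c s * U s $ j)"
        using comb[OF order.refl, of c] by blast
      have "v $ s = c s" if "s \<in> J" for s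
      proof -
        have "v $ s = (\<Sum>s'\<in>J. if s' = s then c s' else 0)"
          using that J unfolding v(2)[OF subsetD[OF J that, simplified]]
          by (intro sum.cong) (auto simp: delta)
        then show ?thesis using that finJ by simp
      qed
      then have "c = (\<lambda>s\<in>J. v $ s)" using c by (auto simp: fun_eq_iff PiE_def extensional_def)
      with v(1) show "c \<in> (\<lambda>w. \<lambda>s\<in>J. w $ s) ` W" by (rule rev_image_eqI)
    qed
    from surj_card_le[OF finW this] have "CARD('a) ^ card J \<le> card W"
      using finJ by (simp add: card_PiE)
    also have "\<dots> \<le> CARD('a) ^ k" using card_subspace_le[OF W finW] dim by simp
    finally have "card J \<le> k" using card_finite_field_gt_1[where 'a='a] by simp
    moreover have "H \<subseteq> carrier_vec n" using H p sub by auto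
    moreover have "\<forall>x\<in>H. x $ j = (p $ j - (\<Sum>s\<in>{s\<in>J. s < j}. U s $ j * p $ s))
        + (\<Sum>s\<in>{s\<in>J. s < j}. U s $ j * x $ s)" if j: "j < n" "j \<notin> J" for j
    proof
      fix x assume "x \<in> H"
      then obtain w where w: "w \<in> W" and x: "x = p + w" by (auto simp: H)
      have x_index: "x $ i = p $ i + w $ i" if "i < n" for i
        using x p w sub that by auto
      have "s < j" if "s \<in> J" "U s $ j \<noteq> 0" for s
        using that lead[OF that(1), of j] j(2) by (metis linorder_neqE_nat)
      then have "w $ j = (\<Sum>s\<in>{s\<in>J. s < j}. U s $ j * w $ s)"
        unfolding expand[OF w j(1)] using finJ
        by (intro sum.mono_neutral_cong_right) auto
      moreover have "(\<Sum>s\<in>{s\<in>J. s < j}. U s $ j * x $ s)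
        = (\<Sum>s\<in>{s\<in>J. s < j}. U s $ j * p $ s) + (\<Sum>s\<in>{s\<in>J. s < j}. U s $ j * w $ s)"
        unfolding sum.distrib[symmetric] using j
        by (intro sum.cong) (auto simp: x_index algebra_simps)
      ultimately show "x $ j = (p $ j - (\<Sum>s\<in>{s\<in>J. s < j}. U s $ j * p $ s))
        + (\<Sum>s\<in>{s\<in>J. s < j}. U s $ j * x $ s)" using j by (simp add: x_index)
    qed
    ultimately show ?thesis using J by (intro that[where J = J and U = "\<lambda>j s. U s $ j"])
  qed
qed

subsection \<open>Evasiveness\<close>

lemma subspace_evasive_evasive_set:
  fixes A :: "'a::{field,finite} mat"
  assumes A: "A \<in> carrier_mat k m" and m: "m > 0" "m dvd n" and reg: "strongly_regular A"
    and dec: "\<And>i j. i < j \<Longrightarrow> j < m \<Longrightarrow> d j < d i" and pos: "\<And>j. j < m \<Longrightarrow> d j \<ge> 1"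
  shows "subspace_evasive n k (d 0 ^ k) (evasive_set n A d)"
  unfolding subspace_evasive_def
proof (intro conjI allI impI)
  let ?S = "evasive_set n A d"
  show sub: "?S \<subseteq> carrier_vec n" by (auto simp: evasive_set_def)
  fix H :: "'a vec set" assume H: "affine_subspace n k H"
  show fin: "finite (?S \<inter> H)" using finite_subset[OF sub finite_carrier_vec] by blast
  obtain J b U where J: "J \<subseteq> {..<n}" "card J \<le> k" and H_sub: "H \<subseteq> carrier_vec n"
    and free: "\<And>j. j < n \<Longrightarrow> j \<notin> J \<Longrightarrow>
      \<forall>x\<in>H. x $ j = b j + (\<Sum>s\<in>{s\<in>J. s < j}. U j s * x $ s)"
    using affine_subspace_pivots[OF H] by blast
  have finJ: "finite J" using J(1) by (rule finite_subset) simp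
  have dims: "dim_row A = k" "dim_col A = m" using A by auto
  have d_le: "d j \<le> d 0" if "j < m" for j using dec[of 0 j] that by (cases j) auto
  define Z where "Z = (\<lambda>x j. x $ j) ` (?S \<inter> H)"
  define D where "D s = d (s mod m)" for s
  \<comment> \<open>\<open>P\<close> is a common multiple of the degrees, so
    \<open>P div D s\<close> is exact and \<open>w s * D s\<close> is the same for all
    \<open>s\<close> in one block.\<close>
  define P where "P = (\<Prod>j<m. d j)"
  define w where "w s = (d 0 + 1) ^ (s div m) * (P div D s)" for s
  have D: "D s \<ge> 1" "D s \<le> d 0" "D s dvd P" for s
    using m(1) pos d_le by (auto simp: D_def P_def)
  have P: "P > 0" unfolding P_def using pos by (intro prod_pos) fastforce
  have wD: "w s * D s = (d 0 + 1) ^ (s div m) * P" for s using D(3)[of s] by (simp add: w_def)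
  have w_pos: "w s > 0" for s
    using wD[of s] P by (cases "w s = 0") auto
  have block_lt: "t * m + j < n" if "t < n div m" "j < m" for t j
  proof -
    have "t * m + j < Suc t * m" using that by simp
    also have "\<dots> \<le> (n div m) * m" using that(1) by (intro mult_le_mono1) simp
    finally show ?thesis using m(2) by simp
  qed
  \<comment> \<open>The \<open>d j\<close>-th power of any coordinate left of position
    \<open>j\<close> in block \<open>t\<close> weighs less than a leading power of that block. In
    the same block this is \<open>d j < D s'\<close>; for an earlier block the extra factor
    \<open>d 0 + 1\<close> beats \<open>d j \<le> d 0\<close>.\<close>
  have weight: "d j * w s' < (d 0 + 1) ^ t * P" if "j < m" "s' < t * m + j" for j s' t
  proof (cases "s' div m = t")
    case True
    have "t * m + s' mod m = s'" using True by (metis div_mult_mod_eq)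
    then have "s' mod m < j" using that(2) by linarith
    then have "d j < D s'" using dec[OF _ that(1)] by (simp add: D_def)
    then have "d j * w s' < w s' * D s'" using w_pos by (simp add: mult.commute)
    then show ?thesis using wD True by simp
  next
    case False
    have "s' div m \<le> (t * m + j) div m" using that(2) by (intro div_le_mono) simp
    also have "\<dots> = t" using that(1) m(1) by simp
    finally have lt: "Suc (s' div m) \<le> t" using False by simp
    have "w s' * 1 \<le> w s' * D s'" by (rule mult_le_mono2) (rule D(1))
    then have "d j * w s' \<le> d 0 * ((d 0 + 1) ^ (s' div m) * P)"
      using d_le[OF that(1)] by (intro mult_le_mono) (simp_all add: wD)
    also have "\<dots> < (d 0 + 1) ^ Suc (s' div m) * P" using P by simp
    also have "\<dots> \<le> (d 0 + 1) ^ t * P" using lt by (intro mult_le_mono1 power_increasing) auto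
    finally show ?thesis .
  qed
  have "inj_on (\<lambda>x j. x $ j) (carrier_vec n :: 'a vec set)"
    by (intro inj_onI eq_vecI) (auto simp: fun_eq_iff)
  then have "inj_on (\<lambda>x j. x $ j) (?S \<inter> H)" by (rule inj_on_subset) (use sub in blast)
  then have "card (?S \<inter> H) = card Z" unfolding Z_def by (rule card_image[symmetric])
  also have "\<dots> \<le> (\<Prod>s\<in>J. D s)"
  proof (rule card_le_prod_degrees[OF finJ])
    show "finite Z" using fin by (simp add: Z_def)
  next
    fix z z' assume z: "z \<in> Z" "z' \<in> Z" "z \<noteq> z'"
    then obtain x x' where x: "x \<in> H" "x' \<in> H" "x \<noteq> x'" "z = ($) x" "z' = ($) x'"
      by (auto simp: Z_def)
    show "\<exists>s\<in>J. z s \<noteq> z' s"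
    proof (rule ccontr)
      assume "\<not> ?thesis"
      then have eq: "x $ s = x' $ s" if "s \<in> J" for s using that x by auto
      have "x $ j = x' $ j" if "j < n" for j
      proof (cases "j \<in> J")
        case False
        then show ?thesis using free[OF that False] x eq by simp
      qed (rule eq)
      moreover have "x \<in> carrier_vec n" "x' \<in> carrier_vec n" using x H_sub by auto
      ultimately have "x = x'" by (intro eq_vecI) auto
      with x show False by simp
    qed
  next
    fix s assume s: "s \<in> J"
    define t where "t = s div m"
    define p where "p = s mod m"
    have s_eq: "t * m + p = s" and p: "p < m" using m(1) by (auto simp: t_def p_def)
    have t: "t < n div m" using s J(1) m by (auto simp: t_def less_mult_imp_div_less)
    define Jt where "Jt = {j. j < m \<and> t * m + j \<in> J}"
    have Jt: "Jt \<subseteq> {..<m}" "p \<in> Jt" using s s_eq p by (auto simp: Jt_def)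
    have "card Jt \<le> card J"
      using finJ by (intro card_inj_on_le[where f = "\<lambda>j. t * m + j"]) (auto simp: Jt_def inj_on_def)
    then have r: "card Jt \<le> k" using J(2) by simp
    obtain C where C: "\<And>j. j \<in> Jt \<Longrightarrow> (\<Sum>i<card Jt. C p i * A $$ (i, j)) = (if p = j then 1 else 0)"
      using ex_inverse_of_minor[OF A reg Jt(1) r] Jt(2) by metis
    \<comment> \<open>Row \<open>p\<close> of the inverse combines the equations of block
      \<open>t\<close>. On \<open>Jt\<close> the coefficients \<open>B\<close> are the indicator of
      \<open>p\<close>, so \<open>x s ^ D s\<close> is the only pivot power left; \<open>h\<close>
      collects the non-pivot terms, each coordinate replaced by its affine expression
      \<open>l j\<close> on \<open>H\<close>.\<close>
    define B where "B j = (\<Sum>i<card Jt. C p i * A $$ (i, j))" for j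
    \<comment> \<open>The largest weight strictly below \<open>w s * D s\<close>.\<close>
    define c where "c = (d 0 + 1) ^ t * P - 1"
    define l where "l j z = b (t * m + j) + (\<Sum>s\<in>{s\<in>J. s < t * m + j}. U (t * m + j) s * z s)"
      for j and z :: "nat \<Rightarrow> 'a"
    define h where "h z = (\<Sum>j\<in>{..<m} - Jt. - B j * l j z ^ d j)" for z
    have "(d 0 + 1) ^ t * P > 0" using P by simp
    then have "c < w s * D s" by (simp add: c_def wD flip: t_def)
    moreover have "(\<lambda>z. - B j * l j z ^ d j) \<in> weighted_polys J w c" if j: "j \<in> {..<m} - Jt" for j
    proof -
      \<comment> \<open>The inserted \<open>0\<close> covers the case of no pivot to the left, where
        \<open>l j\<close> is constant.\<close>
      define e where "e = Max (insert 0 (w ` {s\<in>J. s < t * m + j}))"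
      have fin_w: "finite (insert 0 (w ` {s\<in>J. s < t * m + j}))" using finJ by simp
      have "e \<in> insert 0 (w ` {s\<in>J. s < t * m + j})"
        unfolding e_def by (rule Max_in[OF fin_w]) simp
      then have "d j * e < (d 0 + 1) ^ t * P" using weight j P by auto
      then have "d j * e \<le> c" by (simp add: c_def)
      have "(\<lambda>z. z s') \<in> weighted_polys J w e" if "s' \<in> {s\<in>J. s < t * m + j}" for s'
        using finJ that fin_w by (intro weighted_polys_var) (auto simp: e_def)
      then have "(\<lambda>z. U (t * m + j) s' * z s') \<in> weighted_polys J w e"
        if "s' \<in> {s\<in>J. s < t * m + j}" for s'
        using that weighted_polys_mult[OF _ weighted_polys_const[where c = 0]] by fastforce
      then have "(\<lambda>z. \<Sum>s\<in>{s\<in>J. s < t * m + j}. U (t * m + j) s * z s) \<in> weighted_polys J w e"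
        by (rule weighted_polys_sum)
      from weighted_polys_add[OF this weighted_polys_const]
      have "l j \<in> weighted_polys J w e" unfolding l_def[abs_def] .
      from weighted_polys_mult[OF weighted_polys_power[OF this] weighted_polys_const[where c = 0]]
      have "(\<lambda>z. - B j * l j z ^ d j) \<in> weighted_polys J w (0 + d j * e)" .
      then show ?thesis by (rule weighted_polys_mono) (simp add: \<open>d j * e \<le> c\<close>)
    qed
    then have "h \<in> weighted_polys J w c"
      unfolding h_def[abs_def] by (rule weighted_polys_sum)
    moreover have "\<forall>z\<in>Z. z s ^ D s = h z"
    proof
      fix z assume "z \<in> Z"
      then obtain x where x: "x \<in> ?S" "x \<in> H" and z: "z = ($) x" by (auto simp: Z_def)
      have "diag_poly A d i (block m t x) = 0" if "i < card Jt" for i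
        using x(1) t that r by (auto simp: evasive_set_def dims)
      then have "0 = (\<Sum>i<card Jt. C p i * diag_poly A d i (block m t x))" by simp
      also have "\<dots> = (\<Sum>i<card Jt. \<Sum>j<m. C p i * A $$ (i, j) * x $ (t * m + j) ^ d j)"
        by (intro sum.cong) (auto simp: diag_poly_def dims block_def sum_distrib_left mult.assoc)
      also have "\<dots> = (\<Sum>j<m. B j * x $ (t * m + j) ^ d j)"
        by (subst sum.swap) (simp add: B_def sum_distrib_right)
      also have "\<dots> = (\<Sum>j\<in>Jt. B j * x $ (t * m + j) ^ d j)
          + (\<Sum>j\<in>{..<m} - Jt. B j * x $ (t * m + j) ^ d j)"
        using Jt(1) by (subst sum.subset_diff[of Jt]) auto
      also have "(\<Sum>j\<in>Jt. B j * x $ (t * m + j) ^ d j)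
          = (\<Sum>j\<in>Jt. if p = j then x $ (t * m + j) ^ d j else 0)"
        by (intro sum.cong) (auto simp: B_def C)
      also have "\<dots> = x $ s ^ D s"
        using Jt finite_subset[OF Jt(1)] s_eq by (simp add: D_def p_def)
      also have "(\<Sum>j\<in>{..<m} - Jt. B j * x $ (t * m + j) ^ d j) = - h z"
        unfolding h_def sum_negf[symmetric]
      proof (intro sum.cong refl)
        fix j assume j: "j \<in> {..<m} - Jt"
        then have "t * m + j < n" "t * m + j \<notin> J" using block_lt[OF t] by (auto simp: Jt_def)
        from free[OF this] x(2) have "x $ (t * m + j) = l j z" by (simp add: l_def z)
        then show "B j * x $ (t * m + j) ^ d j = - (- B j * l j z ^ d j)" by simp
      qed
      finally show "z s ^ D s = h z" by (simp add: z)
    qed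
    ultimately show "\<exists>c<w s * D s. \<exists>h\<in>weighted_polys J w c. \<forall>z\<in>Z. z s ^ D s = h z" by blast
  qed
  also have "\<dots> \<le> d 0 ^ card J"
    using D(2) D(1)[of 0] by (intro prod_le_power) (auto intro: le_trans)
  also have "\<dots> \<le> d 0 ^ k"
    using J(2) D(1)[of 0] D(2)[of 0] by (intro power_increasing) (auto simp: D_def)
  finally show "card (?S \<inter> H) \<le> d 0 ^ k" .
qed

subsection \<open>Degrees coprime to the order of the multiplicative group\<close>

lemma card_evasive_set:
  fixes A :: "'a :: {comm_ring_1,finite} mat"
  assumes "dim_col A > 0" "dim_col A dvd n"
  shows "card (evasive_set n A d) = card (common_zeros A d) ^ (n div dim_col A)"
  using bij_betw_same_card[OF evasive_set_bij_common_zeros[OF assms]] by (simp add: card_PiE)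

text \<open>Multiplication by \<open>x\<close> permutes the nonzero elements; compare their
  products.\<close>

lemma finite_field_power_eq_1:
  fixes x :: "'a::{field,finite}"
  assumes "x \<noteq> 0"
  shows "x ^ (CARD('a) - 1) = 1"
proof -
  define U where "U = UNIV - {0::'a}"
  have "bij_betw ((*) x) U U"
    unfolding U_def using assms by (intro bij_betw_byWitness[where f' = "\<lambda>y. y / x"]) auto
  from prod.reindex_bij_betw[OF this, of "\<lambda>y. y"]
  have "x ^ card U * \<Prod>U = \<Prod>U" by (simp add: prod.distrib)
  moreover have "\<Prod>U \<noteq> 0" by (simp add: U_def)
  moreover have "card U = CARD('a) - 1" by (simp add: U_def)
  ultimately show ?thesis by simp
qed

text \<open>Bezout gives \<open>u\<close> with \<open>e * u\<close> congruent to 1 modulo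
  \<open>CARD('a) - 1\<close>, so raising to the power \<open>u\<close> undoes raising to the power
  \<open>e\<close>.\<close>

lemma bij_power_coprime:
  assumes "e \<ge> 1" "coprime e (CARD('a::{field,finite}) - 1)"
  shows "bij (\<lambda>x::'a. x ^ e)"
proof -
  obtain u v where uv: "e * u = (CARD('a) - 1) * v + 1"
    using bezout_nat[of e "CARD('a) - 1"] assms by (auto simp: coprime_iff_gcd_eq_1)
  have "x ^ (e * u) = x" for x :: 'a
    unfolding uv using finite_field_power_eq_1[of x]
    by (cases "x = 0") (simp_all add: power_mult)
  then have "inj (\<lambda>x::'a. x ^ e)"
    by (intro inj_on_inverseI[where g = "\<lambda>y. y ^ u"]) (simp flip: power_mult)
  then show ?thesis by (simp add: bij_def finite_UNIV_inj_surj)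
qed

lemma card_common_zeros_coprime:
  fixes A :: "'a::{field,finite} mat"
  assumes A: "A \<in> carrier_mat k m" and reg: "strongly_regular A"
    and pos: "\<And>j. j < m \<Longrightarrow> d j \<ge> 1"
    and many: "card {j. j < m \<and> coprime (d j) (CARD('a) - 1)} \<ge> k"
  shows "card (common_zeros A d) = CARD('a) ^ (m - k)"
proof -
  obtain J where sub: "J \<subseteq> {j. j < m \<and> coprime (d j) (CARD('a) - 1)}" and cardJ: "card J = k"
    using obtain_subset_with_card_n[OF many] by blast
  then have J: "J \<subseteq> {..<m}" by auto
  have bij: "bij (\<lambda>x::'a. x ^ d j)" if "j \<in> J" for j
    using sub that pos by (intro bij_power_coprime) auto
  have finJ: "finite J" using J by (rule finite_subset) simp
  show ?thesis
  proof (rule ex_inverse_of_minor[OF A reg J, unfolded cardJ, OF order.refl])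
    fix C :: "nat \<Rightarrow> nat \<Rightarrow> 'a"
    assume left: "\<And>p j. p \<in> J \<Longrightarrow> j \<in> J \<Longrightarrow>
      (\<Sum>i<k. C p i * A $$ (i, j)) = (if p = j then 1 else 0)"
    and right: "\<And>i i'. i < k \<Longrightarrow> i' < k \<Longrightarrow>
      (\<Sum>j\<in>J. A $$ (i, j) * C j i') = (if i = i' then 1 else 0)"
    have dims: "dim_row A = k" "dim_col A = m" using A by auto
    define K where "K = {..<m} - J"
    define rest where "rest y i = (\<Sum>j\<in>K. A $$ (i, j) * y j ^ d j)" for y :: "nat \<Rightarrow> 'a" and i
    have split: "diag_poly A d i y = (\<Sum>j\<in>J. A $$ (i, j) * (y $ j) ^ d j) + rest (($) y) i" for i y
      unfolding diag_poly_def dims rest_def K_def using J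
      by (subst sum.subset_diff[OF J]) (auto simp: add.commute)
    \<comment> \<open>The left inverse isolates the power of each variable in \<open>J\<close>;
      injectivity of the projection to \<open>K\<close> follows.\<close>
    have solution: "y $ p ^ d p = - (\<Sum>i<k. C p i * rest (($) y) i)"
      if y: "y \<in> common_zeros A d" and p: "p \<in> J" for y p
    proof -
      have "(\<Sum>j\<in>J. A $$ (i, j) * (y $ j) ^ d j) = - rest (($) y) i" if "i < k" for i
        using y that split[of i y] by (simp add: common_zeros_def dims eq_neg_iff_add_eq_0)
      then have "- (\<Sum>i<k. C p i * rest (($) y) i)
          = (\<Sum>i<k. C p i * (\<Sum>j\<in>J. A $$ (i, j) * (y $ j) ^ d j))"
        by (simp add: sum_negf)
      also have "\<dots> = (\<Sum>j\<in>J. (\<Sum>i<k. C p i * A $$ (i, j)) * (y $ j) ^ d j)"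
        by (simp add: sum_distrib_left sum_distrib_right mult.assoc sum.swap[of _ J])
      also have "\<dots> = (\<Sum>j\<in>J. if p = j then (y $ j) ^ d j else 0)"
        using p by (intro sum.cong) (auto simp: left)
      finally show ?thesis using p finJ by simp
    qed
    have "bij_betw (\<lambda>y. \<lambda>j\<in>K. y $ j) (common_zeros A d) (K \<rightarrow>\<^sub>E UNIV)"
    proof (rule bij_betw_imageI)
      show "inj_on (\<lambda>y. \<lambda>j\<in>K. y $ j) (common_zeros A d)"
      proof (rule inj_onI)
        fix y y' assume y: "y \<in> common_zeros A d" "y' \<in> common_zeros A d"
          and eq: "(\<lambda>j\<in>K. y $ j) = (\<lambda>j\<in>K. y' $ j)"
        have K_eq: "y $ j = y' $ j" if "j \<in> K" for j using eq that by (metis restrict_apply')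
        then have "rest (($) y) = rest (($) y')" by (auto simp: rest_def fun_eq_iff)
        then have "y $ p ^ d p = y' $ p ^ d p" if "p \<in> J" for p
          using solution[OF y(1) that] solution[OF y(2) that] by simp
        then have "y $ p = y' $ p" if "p \<in> J" for p
          using bij[OF that] that by (metis bij_def injD)
        moreover have "y \<in> carrier_vec m" "y' \<in> carrier_vec m"
          using y by (auto simp: common_zeros_def dims)
        ultimately show "y = y'" using K_eq by (intro eq_vecI) (auto simp: K_def)
      qed
      show "(\<lambda>y. \<lambda>j\<in>K. y $ j) ` common_zeros A d = (K \<rightarrow>\<^sub>E UNIV)"
      proof (intro equalityI subsetI)
        fix c :: "nat \<Rightarrow> 'a" assume c: "c \<in> K \<rightarrow>\<^sub>E UNIV"
        define u where "u j = - (\<Sum>i<k. C j i * rest c i)" for j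
        \<comment> \<open>The power maps on \<open>J\<close> are bijective, so roots of the
          prescribed values \<open>u j\<close> exist; the right inverse shows that these values
          satisfy all equations.\<close>
        define y where "y = vec m (\<lambda>j. if j \<in> J then inv_into UNIV (\<lambda>x. x ^ d j) (u j) else c j)"
        have y: "y \<in> carrier_vec m" "\<And>j. j \<in> K \<Longrightarrow> y $ j = c j" by (auto simp: y_def K_def)
        have "y $ j ^ d j = u j" if "j \<in> J" for j
          using subsetD[OF J that] that surj_f_inv_f[OF bij_is_surj[OF bij[OF that]], of "u j"]
          by (simp add: y_def)
        moreover have "rest (($) y) = rest c" using y(2) by (simp add: rest_def fun_eq_iff)
        moreover have "(\<Sum>j\<in>J. A $$ (i, j) * u j) = - rest c i" if i: "i < k" for i
        proof -
          have "(\<Sum>j\<in>J. A $$ (i, j) * u j) = - (\<Sum>i'<k. (\<Sum>j\<in>J. A $$ (i, j) * C j i') * rest c i')"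
            by (simp add: u_def sum_distrib_left sum_distrib_right sum_negf mult.assoc sum.swap[of _ J])
          also have "(\<Sum>i'<k. (\<Sum>j\<in>J. A $$ (i, j) * C j i') * rest c i')
              = (\<Sum>i'<k. if i = i' then rest c i' else 0)"
            using i by (intro sum.cong) (auto simp: right)
          finally show ?thesis using i by simp
        qed
        ultimately have "diag_poly A d i y = 0" if "i < k" for i
          using that by (simp add: split)
        then have "y \<in> common_zeros A d" using y(1) by (simp add: common_zeros_def dims)
        moreover have "c = (\<lambda>j\<in>K. y $ j)"
          using c y(2) by (auto simp: fun_eq_iff PiE_def extensional_def)
        ultimately show "c \<in> (\<lambda>y. \<lambda>j\<in>K. y $ j) ` common_zeros A d" by blast
      qed auto
    qed
    from bij_betw_same_card[OF this] have "card (common_zeros A d) = CARD('a) ^ card K"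
      by (simp add: card_PiE K_def)
    also have "card K = m - k" using J finJ by (simp add: K_def card_Diff_subset cardJ)
    finally show ?thesis .
  qed
qed

subsection \<open>Additive characters and power sums\<close>

text \<open>A subgroup \<open>K\<close> of \<open>\<bbbF>\<close> that is maximal among those without \<open>1\<close> is a complement of the prime field.\<close>

lemma ex_nontrivial_additive_character:
  obtains \<psi> :: "'a::{field,finite} \<Rightarrow> complex"
  where "\<And>x y. \<psi> (x + y) = \<psi> x * \<psi> y" "\<And>x. norm (\<psi> x) = 1" "\<psi> 1 \<noteq> 1"
proof -
  \<comment> \<open>Closure under negation follows from \<open>of_nat (p - 1) = - 1\<close>.\<close>
  define subgroups where
    "subgroups = {K :: 'a set. 0 \<in> K \<and> (\<forall>x\<in>K. \<forall>y\<in>K. x + y \<in> K) \<and> 1 \<notin> K}"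
  define p where "p = CHAR('a)"
  have p_pos: "p > 0" unfolding p_def by (rule finite_imp_CHAR_pos) simp
  have p: "prime p" using p_pos unfolding p_def by (rule prime_CHAR_semidom)
  have "{0} \<in> subgroups" by (simp add: subgroups_def)
  then obtain K where K: "K \<in> subgroups" and max: "\<And>K'. K' \<in> subgroups \<Longrightarrow> K \<subseteq> K' \<Longrightarrow> K = K'"
    using finite_has_maximal[of subgroups] by (metis empty_iff finite)
  have K0: "0 \<in> K" and K_add: "\<And>x y. x \<in> K \<Longrightarrow> y \<in> K \<Longrightarrow> x + y \<in> K" and K1: "1 \<notin> K"
    using K by (auto simp: subgroups_def)
  have K_nat: "of_nat i * x \<in> K" if "x \<in> K" for i x
    using that by (induction i) (auto simp: K0 algebra_simps intro: K_add)
  have K_neg: "- x \<in> K" if "x \<in> K" for x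
  proof -
    have "of_nat (p - 1) = (- 1 :: 'a)" using p_pos by (simp add: of_nat_diff p_def)
    then show ?thesis using K_nat[OF that, of "p - 1"] by simp
  qed
  have K_int: "of_int i * x \<in> K" if "x \<in> K" for i x
  proof (cases i rule: int_cases2)
    case (nonneg j)
    then show ?thesis using K_nat[OF that, of j] by simp
  next
    case (nonpos j)
    then show ?thesis using K_neg[OF K_nat[OF that, of j]] by simp
  qed
  have inverse_mod: "\<exists>i'. of_int (i' * i) = (1 :: 'a)" if "\<not> int p dvd i" for i
  proof -
    have "coprime i (int p)"
      using p that by (metis coprime_commute prime_imp_coprime prime_nat_int_transfer)
    then obtain i' where "[i * i' = 1] (mod int p)" using cong_solve_coprime_int by blast
    then have "of_int (i' * i) = (of_int 1 :: 'a)"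
      unfolding p_def of_int_eq_iff_cong_CHAR by (simp add: mult.commute)
    then show ?thesis by auto
  qed
  have dvd: "int p dvd i" if "of_int i \<in> K" for i
    using K_int[OF that] inverse_mod[of i] K1 by (metis of_int_mult)
  \<comment> \<open>If \<open>x\<close> is not in \<open>K\<close>, the subgroup \<open>K'\<close>
    generated by \<open>K\<close> and \<open>x\<close> contains 1 by maximality; the multiple of
    \<open>x\<close> in that representation of 1 is invertible modulo \<open>p\<close>, which gives
    \<open>x\<close> modulo \<open>K\<close>.\<close>
  have "\<exists>i. x - of_int i \<in> K" for x
  proof (cases "x \<in> K")
    case True
    then show ?thesis by (intro exI[of _ 0]) simp
  next
    case False
    define K' where "K' = {y + of_int i * x | y i. y \<in> K}"
    have K'I: "y + of_int i * x \<in> K'" if "y \<in> K" for y i using that by (auto simp: K'_def)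
    have "K \<subseteq> K'" using K'I[of _ 0] by auto
    moreover have "x \<in> K'" using K'I[OF K0, of 1] by simp
    moreover have "y + z \<in> K'" if yz: "y \<in> K'" "z \<in> K'" for y z
    proof -
      obtain a i b j where "y = a + of_int i * x" "z = b + of_int j * x" "a \<in> K" "b \<in> K"
        using yz by (auto simp: K'_def)
      then have "y + z = (a + b) + of_int (i + j) * x" "a + b \<in> K"
        by (auto simp: algebra_simps intro: K_add)
      then show ?thesis using K'I by metis
    qed
    ultimately have "1 \<in> K'"
      using max[of K'] False K0 by (auto simp: subgroups_def)
    then obtain y i where y: "y \<in> K" "1 = y + of_int i * x" by (auto simp: K'_def)
    then have "of_int i \<noteq> (0 :: 'a)" using K1 by auto
    then have "\<not> int p dvd i" by (simp add: p_def of_int_eq_0_iff_char_dvd)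
    from inverse_mod[OF this] obtain i' where i': "of_int (i' * i) = (1 :: 'a)" ..
    have "of_int i' * 1 = of_int i' * y + of_int (i' * i) * x"
      by (subst y(2)) (simp add: distrib_left mult.assoc)
    then have eq: "of_int i' = of_int i' * y + x" unfolding i' by simp
    have "x - a = - b" if "a = b + x" for a b using that by simp
    from this[OF eq] have "x - of_int i' = - (of_int i' * y)" .
    then show ?thesis using K_neg[OF K_int[OF y(1), of i']] by metis
  qed
  then obtain r where r: "\<And>x. x - of_int (r x) \<in> K" by metis
  \<comment> \<open>\<open>r x\<close> represents the prime-field component of \<open>x\<close>. It
    is additive only modulo \<open>p\<close>, which \<open>cis\<close> does not see.\<close>
  define \<psi> where "\<psi> x = cis (2 * pi * (r x / p))" for x
  have cis_eq_1: "cis (2 * pi * (i / p)) = 1" if "int p dvd i" for i :: int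
  proof -
    from that obtain l where "i = int p * l" by (elim dvdE)
    then have "real_of_int i / p = of_int l" using p_pos by simp
    then show ?thesis by simp
  qed
  have "\<psi> (x + y) = \<psi> x * \<psi> y" for x y
  proof -
    have "of_int (r (x + y) - r x - r y)
        = (x - of_int (r x)) + (y - of_int (r y)) + - (x + y - of_int (r (x + y)))"
      by simp
    also have "\<dots> \<in> K" by (intro K_add K_neg r)
    finally have 1: "cis (2 * pi * (of_int (r (x + y) - r x - r y) / p)) = 1"
      using dvd cis_eq_1 by blast
    have "\<psi> (x + y) = \<psi> x * \<psi> y * cis (2 * pi * (of_int (r (x + y) - r x - r y) / p))"
      unfolding \<psi>_def cis_mult using p_pos
      by (intro arg_cong[of _ _ cis]) (simp add: field_simps)
    then show ?thesis unfolding 1 by simp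
  qed
  moreover have "norm (\<psi> x) = 1" for x by (simp add: \<psi>_def)
  moreover have "\<psi> 1 \<noteq> 1"
  proof
    assume "\<psi> 1 = 1"
    then have "cos (2 * pi * (r 1 / p)) = 1" by (metis \<psi>_def cis.sel(1) one_complex.sel(1))
    then obtain l :: int where "2 * pi * (r 1 / p) = l * 2 * pi" by (auto simp: cos_one_2pi_int)
    then have "real_of_int (r 1) = of_int (int p * l)" using p_pos by (simp add: field_simps)
    then have "r 1 = int p * l" by (simp only: of_int_eq_iff)
    then have "(of_int (r 1) :: 'a) = 0" by (simp add: of_int_eq_0_iff_char_dvd p_def)
    then show False using r[of 1] K1 by simp
  qed
  ultimately show ?thesis by (rule that)
qed

lemma card_power_eq_le:
  fixes a :: "'a::{field,finite}"
  assumes "e \<ge> 1"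
  shows "card {x. x ^ e = a} \<le> e"
proof -
  define f where "f = monom 1 e + [:- a:]"
  have deg: "degree f = e"
    unfolding f_def using assms by (subst degree_add_eq_left) (auto simp: degree_monom_eq)
  have "{x. x ^ e = a} = {x. poly f x = 0}" by (auto simp: f_def poly_monom)
  moreover have "f \<noteq> 0" using deg assms by auto
  ultimately show ?thesis using card_poly_roots_bound[of f] deg by simp
qed

locale additive_character =
  fixes \<psi> :: "'a::{field,finite} \<Rightarrow> complex"
  assumes add: "\<psi> (x + y) = \<psi> x * \<psi> y" and norm_eq_1: "norm (\<psi> x) = 1"
    and nontrivial: "\<psi> 1 \<noteq> 1"
begin

lemma zero [simp]: "\<psi> 0 = 1"
  using add[of 0 0] norm_eq_1[of 0] by auto

lemma sum: "\<psi> (\<Sum>i\<in>I. f i) = (\<Prod>i\<in>I. \<psi> (f i))"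
  by (induction I rule: infinite_finite_induct) (simp_all add: add)

lemma cnj: "cnj (\<psi> x) = \<psi> (- x)"
proof -
  have "\<psi> (- x) * \<psi> x = 1" by (simp flip: add)
  moreover have "cnj (\<psi> x) * \<psi> x = 1"
    using complex_norm_square[of "\<psi> x"] norm_eq_1[of x] by (simp add: mult.commute)
  moreover have "\<psi> x \<noteq> 0" using norm_eq_1[of x] by auto
  ultimately show ?thesis by (metis mult_right_cancel)
qed

text \<open>For \<open>c \<noteq> 0\<close>, shifting \<open>u\<close> by \<open>1 / c\<close>
  permutes the terms but multiplies the sum by \<open>\<psi> 1 \<noteq> 1\<close>.\<close>

lemma orthogonality: "(\<Sum>u\<in>UNIV. \<psi> (u * c)) = (if c = 0 then of_nat CARD('a) else 0)"
proof (cases "c = 0")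
  case False
  have "bij_betw (\<lambda>u. u + 1 / c) UNIV (UNIV :: 'a set)"
    by (intro bij_betw_byWitness[where f' = "\<lambda>u. u - 1 / c"]) auto
  from sum.reindex_bij_betw[OF this, of "\<lambda>u. \<psi> (u * c)"]
  have "(\<Sum>u\<in>UNIV. \<psi> (u * c)) * \<psi> 1 = (\<Sum>u\<in>UNIV. \<psi> (u * c))"
    using False by (simp add: distrib_right add sum_distrib_right)
  then show ?thesis using nontrivial False by auto
qed simp

definition power_sum :: "nat \<Rightarrow> 'a \<Rightarrow> complex" where
  "power_sum e c = (\<Sum>x\<in>UNIV. \<psi> (c * x ^ e))"

lemma power_sum_zero: "power_sum e 0 = of_nat CARD('a)"
  by (simp add: power_sum_def)

text \<open>Expand the squared norm and sum over \<open>c\<close> first: orthogonality keeps the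
  pairs with equal \<open>e\<close>-th powers.\<close>

lemma sum_norm_power_sum:
  "(\<Sum>c\<in>UNIV. (norm (power_sum e c))\<^sup>2) = CARD('a) * (\<Sum>x\<in>UNIV. card {y :: 'a. y ^ e = x ^ e})"
proof -
  have "complex_of_real (\<Sum>c\<in>UNIV. (norm (power_sum e c))\<^sup>2)
      = (\<Sum>c\<in>UNIV. power_sum e c * cnj (power_sum e c))"
    by (simp only: of_real_sum complex_norm_square)
  also have "\<dots> = (\<Sum>c\<in>UNIV. \<Sum>x\<in>UNIV. \<Sum>y\<in>UNIV. \<psi> (c * (x ^ e - y ^ e)))"
    unfolding power_sum_def cnj_sum sum_product cnj
    by (simp add: algebra_simps flip: add)
  also have "\<dots> = (\<Sum>x\<in>UNIV. \<Sum>y\<in>UNIV. \<Sum>c\<in>UNIV. \<psi> (c * (x ^ e - y ^ e)))"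
    by (subst sum.swap) (intro sum.cong refl sum.swap)
  also have "\<dots> = (\<Sum>x\<in>UNIV. \<Sum>y\<in>UNIV. if y ^ e = (x :: 'a) ^ e then of_nat CARD('a) else 0)"
    unfolding orthogonality by (intro sum.cong refl) auto
  also have "\<dots> = complex_of_real (CARD('a) * (\<Sum>x\<in>UNIV. card {y :: 'a. y ^ e = x ^ e}))"
    by (simp add: sum.If_cases sum_distrib_left mult.commute)
  finally show ?thesis by (simp only: of_real_eq_iff)
qed

text \<open>\<open>power_sum e\<close> is constant on the cosets of the nonzero \<open>e\<close>-th powers, so a single
  value is controlled by the second moment over all \<open>c \<noteq> 0\<close>.\<close>

lemma norm_power_sum_le:
  assumes e: "e \<ge> 1" and c: "c \<noteq> 0"
  shows "(norm (power_sum e c))\<^sup>2 \<le> e\<^sup>2 * CARD('a)"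
proof -
  define q where "q = CARD('a)"
  define U where "U = UNIV - {0::'a}"
  define F where "F c = (norm (power_sum e c))\<^sup>2" for c
  have q: "q > 1" unfolding q_def by (rule card_finite_field_gt_1)
  have U: "card U = q - 1" "finite U" by (simp_all add: U_def q_def)
  have const: "F (c * b ^ e) = F c" if "b \<in> U" for b
  proof -
    have "bij_betw ((*) b) UNIV UNIV"
      using that by (intro bij_betw_byWitness[where f' = "\<lambda>y. y / b"]) (auto simp: U_def)
    from sum.reindex_bij_betw[OF this, of "\<lambda>x. \<psi> (c * x ^ e)"]
    show ?thesis by (simp add: F_def power_sum_def power_mult_distrib mult_ac)
  qed
  have fibre: "card {b \<in> U. c * b ^ e = a} \<le> e" for a
  proof -
    have "{b \<in> U. c * b ^ e = a} \<subseteq> {b. b ^ e = a / c}" using c by auto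
    then show ?thesis using card_power_eq_le[OF e, of "a / c"] card_mono[of "{b. b ^ e = a / c}"]
      by (meson finite le_trans)
  qed
  \<comment> \<open>Average over the coset of \<open>c\<close> and regroup by
    \<open>a = c * b ^ e\<close>; each \<open>a\<close> arises from at most \<open>e\<close> values
    of \<open>b\<close>.\<close>
  have "(q - 1) * F c = (\<Sum>b\<in>U. F (c * b ^ e))"
    using U by (simp add: const)
  also have "\<dots> = (\<Sum>a\<in>U. \<Sum>b\<in>{b \<in> U. c * b ^ e = a}. F (c * b ^ e))"
    using c by (intro sum.group[symmetric]) (auto simp: U_def)
  also have "\<dots> = (\<Sum>a\<in>U. card {b \<in> U. c * b ^ e = a} * F a)"
    by (intro sum.cong) simp_all
  also have "\<dots> \<le> (\<Sum>a\<in>U. e * F a)"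
    using fibre by (intro sum_mono mult_right_mono) (auto simp: F_def)
  also have "\<dots> = e * ((\<Sum>a\<in>UNIV. F a) - q\<^sup>2)"
    by (simp add: U_def sum_diff1 F_def power_sum_zero q_def flip: sum_distrib_left)
  \<comment> \<open>Pairs with equal powers: \<open>x = 0\<close> has only the partner 0, every
    other \<open>x\<close> at most \<open>e\<close> partners. The subtracted
    \<open>q\<^sup>2\<close> is the term \<open>a = 0\<close>.\<close>
  also have "\<dots> \<le> e * (real (q * (1 + (q - 1) * e)) - q\<^sup>2)"
  proof (intro mult_left_mono diff_right_mono)
    have "(\<Sum>x\<in>UNIV. card {y :: 'a. y ^ e = x ^ e})
        = card {y :: 'a. y ^ e = 0 ^ e} + (\<Sum>x\<in>U. card {y :: 'a. y ^ e = x ^ e})"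
      unfolding U_def by (rule sum.remove) simp_all
    also have "{y :: 'a. y ^ e = 0 ^ e} = {0}" using e by (auto simp: power_0_left)
    also have "(\<Sum>x\<in>U. card {y :: 'a. y ^ e = x ^ e}) \<le> (\<Sum>x\<in>U. e)"
      by (intro sum_mono card_power_eq_le e)
    finally have "(\<Sum>x\<in>UNIV. card {y :: 'a. y ^ e = x ^ e}) \<le> 1 + (q - 1) * e"
      by (simp add: U)
    then have "q * (\<Sum>x\<in>UNIV. card {y :: 'a. y ^ e = x ^ e}) \<le> q * (1 + (q - 1) * e)"
      by (rule mult_le_mono2)
    then show "(\<Sum>a\<in>UNIV. F a) \<le> real (q * (1 + (q - 1) * e))"
      unfolding F_def sum_norm_power_sum q_def[symmetric] by (simp only: of_nat_le_iff)
  qed simp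
  also have "\<dots> = (real q - 1) * (real e * (real e - 1) * q)"
  proof -
    obtain r where "q = Suc r" using q by (cases q) auto
    then show ?thesis by (simp add: algebra_simps power2_eq_square)
  qed
  finally have "(real q - 1) * F c \<le> (real q - 1) * (real e * (real e - 1) * q)"
    using q by simp
  then have "F c \<le> real e * (real e - 1) * q" using q by simp
  also have "\<dots> \<le> real e * real e * q" by (intro mult_right_mono mult_left_mono) auto
  finally show ?thesis by (simp add: F_def q_def power2_eq_square)
qed

end

subsection \<open>Small degrees\<close>

text \<open>Orthogonality in each \<open>u i\<close> detects common zeros with multiplicity
  \<open>CARD('a) ^ k\<close>. Since the polynomials are diagonal, for fixed \<open>u\<close> the
  sum over points factors over the coordinates.\<close>

lemma (in additive_character) card_common_zeros_character_sum:
  assumes A: "A \<in> carrier_mat k m"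
  shows "of_nat (CARD('a) ^ k * card (common_zeros A d))
    = (\<Sum>u\<in>{..<k} \<rightarrow>\<^sub>E UNIV. \<Prod>j<m. power_sum (d j) (\<Sum>i<k. u i * A $$ (i, j)))"
proof -
  have dims: "dim_row A = k" "dim_col A = m" using A by auto
  define Y where "Y = ({..<m} \<rightarrow>\<^sub>E UNIV :: (nat \<Rightarrow> 'a) set)"
  define F where "F y i = (\<Sum>j<m. A $$ (i, j) * y j ^ d j)" for y :: "nat \<Rightarrow> 'a" and i
  have finY: "finite Y" by (simp add: Y_def finite_PiE)
  have "bij_betw (\<lambda>x. \<lambda>j\<in>{..<m}. x $ j) (common_zeros A d) {y \<in> Y. \<forall>i<k. F y i = 0}"
    by (rule bij_betw_byWitness[where f' = "vec m"])
      (auto simp: common_zeros_def diag_poly_def dims Y_def F_def fun_eq_iff extensional_def PiE_def)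
  then have card: "card (common_zeros A d) = card {y \<in> Y. \<forall>i<k. F y i = 0}"
    by (rule bij_betw_same_card)
  have swap: "(\<Sum>j<m. (\<Sum>i<k. u i * A $$ (i, j)) * y j ^ d j) = (\<Sum>i<k. u i * F y i)" for u y
    unfolding F_def sum_distrib_left sum_distrib_right
    by (subst sum.swap) (simp add: mult.assoc)
  have "(\<Sum>u\<in>{..<k} \<rightarrow>\<^sub>E UNIV. \<Prod>j<m. power_sum (d j) (\<Sum>i<k. u i * A $$ (i, j)))
      = (\<Sum>u\<in>{..<k} \<rightarrow>\<^sub>E UNIV. \<Sum>y\<in>Y. \<Prod>j<m. \<psi> ((\<Sum>i<k. u i * A $$ (i, j)) * y j ^ d j))"
    unfolding power_sum_def Y_def by (intro sum.cong refl prod_sum_PiE) simp_all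
  also have "\<dots> = (\<Sum>u\<in>{..<k} \<rightarrow>\<^sub>E UNIV. \<Sum>y\<in>Y. \<Prod>i<k. \<psi> (u i * F y i))"
    by (simp only: swap flip: sum)
  also have "\<dots> = (\<Sum>y\<in>Y. \<Sum>u\<in>{..<k} \<rightarrow>\<^sub>E UNIV. \<Prod>i<k. \<psi> (u i * F y i))"
    by (rule sum.swap)
  also have "\<dots> = (\<Sum>y\<in>Y. \<Prod>i<k. \<Sum>u\<in>UNIV. \<psi> (u * F y i))"
    by (intro sum.cong refl prod_sum_PiE[symmetric]) simp_all
  also have "\<dots> = (\<Sum>y\<in>Y. if \<forall>i<k. F y i = 0 then of_nat CARD('a) ^ k else 0)"
    by (intro sum.cong refl) (auto simp: orthogonality prod_zero_iff)
  also have "\<dots> = of_nat (CARD('a) ^ k * card (common_zeros A d))"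
    using finY by (simp add: card sum.If_cases Int_def conj_commute)
  finally show ?thesis by simp
qed

text \<open>\<open>Q\<close> is \<open>|\<bbbF>|\<^sup>1\<^sup>/\<^sup>4\<close>, so that all bounds are integral powers of \<open>Q\<close>.\<close>

lemma (in additive_character) norm_prod_power_sum_le:
  fixes A :: "'a mat"
  assumes A: "A \<in> carrier_mat k m" and reg: "strongly_regular A"
    and d: "\<And>j. j < m \<Longrightarrow> 1 \<le> d j" "\<And>j. j < m \<Longrightarrow> real (d j) \<le> Q"
    and Q: "Q ^ 4 = real CARD('a)" "Q \<ge> 1"
    and u: "i < k" "u i \<noteq> 0"
  shows "norm (\<Prod>j<m. power_sum (d j) (\<Sum>i<k. u i * A $$ (i, j))) \<le> Q ^ (3 * m + (k - 1))"
proof -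
  define v where "v j = (\<Sum>i<k. u i * A $$ (i, j))" for j
  define T where "T = {j \<in> {..<m}. v j = 0}"
  \<comment> \<open>If \<open>k\<close> coordinates of \<open>u A\<close> vanished, the invertible
    minor on those columns would force \<open>u = 0\<close>.\<close>
  have "card T < k"
  proof (rule ccontr)
    assume "\<not> card T < k"
    then obtain J where sub: "J \<subseteq> T" and cardJ: "card J = k"
      using obtain_subset_with_card_n[of k T] by (auto simp: not_less)
    then have J: "J \<subseteq> {..<m}" by (auto simp: T_def)
    show False
    proof (rule ex_inverse_of_minor[OF A reg J, unfolded cardJ, OF order.refl])
      fix C :: "nat \<Rightarrow> nat \<Rightarrow> 'a"
      assume right: "\<And>i i'. i < k \<Longrightarrow> i' < k \<Longrightarrow>
        (\<Sum>j\<in>J. A $$ (i, j) * C j i') = (if i = i' then 1 else 0)"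
      have "v j = 0" if "j \<in> J" for j using sub that by (auto simp: T_def)
      then have "0 = (\<Sum>j\<in>J. v j * C j i)" by simp
      also have "\<dots> = (\<Sum>i'<k. u i' * (\<Sum>j\<in>J. A $$ (i', j) * C j i))"
        unfolding v_def sum_distrib_left sum_distrib_right
        by (subst sum.swap) (simp add: mult.assoc)
      also have "\<dots> = (\<Sum>i'<k. if i' = i then u i' else 0)"
        using u(1) by (intro sum.cong) (auto simp: right)
      finally show False using u by simp
    qed
  qed
  \<comment> \<open>A vanishing coordinate contributes \<open>Q ^ 4\<close>; any other at most
    \<open>d j * Q ^ 2 \<le> Q ^ 3\<close>.\<close>
  have "norm (power_sum (d j) (v j)) \<le> Q ^ 3 * (if j \<in> T then Q else 1)" if j: "j < m" for j
  proof (cases "v j = 0")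
    case True
    then show ?thesis using j Q(1) by (simp add: T_def power_sum_zero power4_eq_xxxx power3_eq_cube)
  next
    case False
    have "(norm (power_sum (d j) (v j)))\<^sup>2 \<le> real (d j) ^ 2 * Q ^ 4"
      using norm_power_sum_le[OF d(1)[OF j] False] Q(1) by simp
    also have "\<dots> \<le> Q ^ 2 * Q ^ 4"
      using d(2)[OF j] by (intro mult_right_mono power_mono) auto
    also have "\<dots> = (Q ^ 3)\<^sup>2" by (simp flip: power_add power_mult)
    finally have "norm (power_sum (d j) (v j)) \<le> Q ^ 3"
      by (rule power2_le_imp_le) (use Q(2) in simp)
    then show ?thesis using False by (simp add: T_def)
  qed
  then have "norm (\<Prod>j<m. power_sum (d j) (v j)) \<le> (\<Prod>j<m. Q ^ 3 * (if j \<in> T then Q else 1))"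
    unfolding prod_norm[symmetric] by (intro prod_mono) auto
  also have "\<dots> = Q ^ (3 * m) * Q ^ card T"
  proof -
    have "T \<subseteq> {..<m}" by (auto simp: T_def)
    then have "{..<m} \<inter> T = T" by blast
    then show ?thesis
      by (simp add: prod.distrib prod.If_cases flip: power_mult)
  qed
  also have "\<dots> \<le> Q ^ (3 * m) * Q ^ (k - 1)"
    using \<open>card T < k\<close> Q(2) by (intro mult_left_mono power_increasing) auto
  finally show ?thesis by (simp add: v_def power_add)
qed

text \<open>In the character sum \<open>u = 0\<close> contributes \<open>CARD('a) ^ m\<close>, and
  each of the fewer than \<open>CARD('a) ^ k\<close> other terms is bounded by the product estimate.
  Divide by \<open>CARD('a) ^ k\<close>.\<close>

lemma card_common_zeros_ge:
  fixes A :: "'a::{field,finite} mat"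
  assumes A: "A \<in> carrier_mat k m" and reg: "strongly_regular A" and km: "k \<le> m"
    and d: "\<And>j. j < m \<Longrightarrow> 1 \<le> d j" "\<And>j. j < m \<Longrightarrow> real (d j) \<le> Q"
    and Q: "Q ^ 4 = real CARD('a)" "Q \<ge> 1"
  shows "real (card (common_zeros A d)) \<ge> Q ^ (4 * (m - k)) - Q ^ (3 * m + (k - 1))"
proof -
  obtain \<psi> :: "'a \<Rightarrow> complex" where "\<And>x y. \<psi> (x + y) = \<psi> x * \<psi> y" "\<And>x. norm (\<psi> x) = 1" "\<psi> 1 \<noteq> 1"
    by (rule ex_nontrivial_additive_character) blast
  then interpret additive_character \<psi> by unfold_locales
  define G where "G u = (\<Prod>j<m. power_sum (d j) (\<Sum>i<k. u i * A $$ (i, j)))" for u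
  define W where "W = ({..<k} \<rightarrow>\<^sub>E UNIV :: (nat \<Rightarrow> 'a) set)"
  define u0 where "u0 = (\<lambda>i\<in>{..<k}. 0 :: 'a)"
  define M where "M = Q ^ (3 * m + (k - 1))"
  have W: "finite W" "card W = CARD('a) ^ k" by (simp_all add: W_def finite_PiE card_PiE)
  have u0: "u0 \<in> W" by (simp add: W_def u0_def)
  have Gu0: "G u0 = of_nat (CARD('a) ^ m)" by (simp add: G_def u0_def power_sum_zero)
  have G_le: "norm (G u) \<le> M" if u: "u \<in> W - {u0}" for u
  proof -
    obtain i where "i < k" "u i \<noteq> 0"
      using u by (auto simp: W_def u0_def fun_eq_iff PiE_def extensional_def split: if_splits)
    then show ?thesis
      unfolding G_def M_def by (intro norm_prod_power_sum_le A reg d Q)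
  qed
  have M: "M \<ge> 0" using Q(2) by (simp add: M_def)
  have "of_nat (CARD('a) ^ k * card (common_zeros A d)) = G u0 + (\<Sum>u\<in>W - {u0}. G u)"
    unfolding card_common_zeros_character_sum[OF A] G_def[symmetric] W_def[symmetric]
    using W u0 by (intro sum.remove)
  then have "of_nat (CARD('a) ^ k * card (common_zeros A d)) - of_nat (CARD('a) ^ m)
      = (\<Sum>u\<in>W - {u0}. G u)" by (simp add: Gu0)
  then have "\<bar>real (CARD('a) ^ k * card (common_zeros A d)) - real (CARD('a) ^ m)\<bar>
      = norm (\<Sum>u\<in>W - {u0}. G u)"
    by (metis norm_of_real of_real_diff of_real_of_nat_eq)
  also have "\<dots> \<le> (\<Sum>u\<in>W - {u0}. M)"
    by (rule sum_norm_le) (rule G_le)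
  also have "\<dots> \<le> (\<Sum>u\<in>W. M)" using W M by (intro sum_mono2) auto
  finally have "real CARD('a) ^ m - real CARD('a) ^ k * M
      \<le> real CARD('a) ^ k * real (card (common_zeros A d))"
    using W by simp
  moreover have "real CARD('a) ^ m = real CARD('a) ^ k * Q ^ (4 * (m - k))"
    using km by (simp add: power_mult Q(1) flip: power_add)
  ultimately have "real CARD('a) ^ k * (Q ^ (4 * (m - k)) - M)
      \<le> real CARD('a) ^ k * real (card (common_zeros A d))"
    by (simp add: right_diff_distrib)
  then show ?thesis unfolding M_def by (subst (asm) mult_le_cancel_left_pos) auto
qed

text \<open>Per block, the main term exceeds the error by a factor \<open>X \<ge> n\<close>. So each
  of the at most \<open>n / 10\<close> blocks loses a factor of at most \<open>1 - 1 / n\<close>,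
  and Bernoulli bounds the total loss.\<close>

lemma card_evasive_set_ge:
  fixes A :: "'a::{field,finite} mat"
  assumes A: "A \<in> carrier_mat k m" and reg: "strongly_regular A"
    and k: "k \<ge> 1" "10 * k \<le> m" and dvd: "m dvd n"
    and d: "\<And>j. j < m \<Longrightarrow> 1 \<le> d j" "\<And>j. j < m \<Longrightarrow> real (d j) \<le> Q"
    and Q: "Q ^ 4 = real CARD('a)" "Q \<ge> 1"
    and n: "CARD('a) ^ m \<ge> n ^ 8"
  shows "real (card (evasive_set n A d)) \<ge> 1 / 3 * real CARD('a) ^ ((m - k) * (n div m))"
proof (cases "n = 0")
  case True
  then show ?thesis using card_evasive_set[of A n d] A k by simp
next
  case False
  define N where "N = n div m"
  define X where "X = Q ^ (m + 1 - 5 * k)"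
  have "real n ^ 8 \<le> real CARD('a) ^ m"
    using n by (simp only: of_nat_le_iff flip: of_nat_power)
  also have "\<dots> = Q ^ (4 * m)" by (simp add: power_mult Q(1))
  \<comment> \<open>\<open>4 * m \<le> 8 * (m + 1 - 5 * k)\<close> follows from
    \<open>10 * k \<le> m\<close>.\<close>
  also have "\<dots> \<le> Q ^ ((m + 1 - 5 * k) * 8)" using k Q(2) by (intro power_increasing) auto
  also have "\<dots> = X ^ 8" by (simp add: X_def power_mult)
  finally have X: "real n \<le> X"
    using Q(2) by (simp add: X_def power_mono_iff)
  define R where "R = Q ^ (3 * m + (k - 1))"
  have R: "R > 0" using Q(2) by (simp add: R_def)
  have XR: "Q ^ (4 * (m - k)) = X * R"
    unfolding X_def R_def power_add[symmetric] using k by (intro arg_cong[of _ _ "power Q"]) simp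
  have N: "N * 10 \<le> n"
  proof -
    have "N * 10 \<le> N * m" using k by (intro mult_le_mono2) simp
    then show ?thesis using dvd by (simp add: N_def)
  qed
  \<comment> \<open>\<open>n \<le> X\<close> bounds the error \<open>R\<close> by
    \<open>X * R / n\<close>.\<close>
  have "X * R * (1 - 1 / n) \<le> X * R - R"
    using X R False by (simp add: field_simps)
  also have "\<dots> \<le> real (card (common_zeros A d))"
    using card_common_zeros_ge[OF A reg _ d Q] k XR by (simp add: R_def)
  finally have "(X * R * (1 - 1 / n)) ^ N \<le> real (card (common_zeros A d)) ^ N"
    using X R False by (intro power_mono mult_nonneg_nonneg) (auto simp: field_simps)
  also have "\<dots> = real (card (evasive_set n A d))"
    using card_evasive_set[of A n d] A k dvd by (simp add: N_def)
  finally have "(X * R) ^ N * (1 - 1 / n) ^ N \<le> real (card (evasive_set n A d))"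
    by (simp add: power_mult_distrib)
  moreover have "1 / 3 \<le> (1 - 1 / real n) ^ N"
  proof -
    have "1 + real N * (- 1 / n) \<le> (1 + (- 1 / n)) ^ N"
      using False by (intro Bernoulli_inequality) (auto simp: field_simps)
    moreover have "real N * (1 / n) \<le> 1 / 10"
      using N False by (simp add: field_simps)
    ultimately show ?thesis by simp
  qed
  ultimately have "(X * R) ^ N * (1 / 3) \<le> real (card (evasive_set n A d))"
    using X R by (meson mult_left_mono of_nat_0_le_iff order_trans zero_le_power mult_nonneg_nonneg less_imp_le)
  moreover have "real CARD('a) ^ ((m - k) * N) = (X * R) ^ N"
    unfolding XR[symmetric] by (simp add: power_mult Q(1))
  ultimately show ?thesis by (simp add: N_def)
qed

theorem theorem3p2:
  fixes k m n :: nat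
    and \<epsilon> :: real
    and A :: "'a :: {field, finite} mat"
    and d :: "nat \<Rightarrow> nat"
  defines "S \<equiv> evasive_set n A d"
  assumes "k \<ge> 1"
    and "\<epsilon> > 0"
    and "real m = real k / \<epsilon>"
    and "m dvd n"
    and "A \<in> carrier_mat k m"
    and "strongly_regular A"
    and "\<And>i j. i < j \<Longrightarrow> j < m \<Longrightarrow> d j < d i"
    and "\<And>j. j < m \<Longrightarrow> d j \<ge> 1"
  shows "subspace_evasive n k (d 0 ^ k) S
    \<and> (\<epsilon> \<le> 1 / 10 \<and> real (d 0) \<le> real CARD('a) powr (1 / 4) \<and> CARD('a) ^ m \<ge> n ^ 8
         \<longrightarrow> real (card S) \<ge> 1 / 3 * real CARD('a) powr ((1 - \<epsilon>) * real n))
    \<and> (card {j. j < m \<and> coprime (d j) (CARD('a) - 1)} \<ge> k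
         \<longrightarrow> real (card S) = real CARD('a) powr ((1 - \<epsilon>) * real n))"
proof -
  have m: "m > 0" using assms(2-4) by (intro gr0I) auto
  have k_eq: "real k = \<epsilon> * m" using assms(3,4) by simp
  \<comment> \<open>With \<open>k = \<epsilon> * m\<close>, the real exponent
    \<open>(1 - \<epsilon>) * n\<close> is the natural number \<open>(m - k) * (n div m)\<close>;
    \<open>k \<le> m\<close> keeps the subtraction exact.\<close>
  have powr: "real CARD('a) powr ((1 - \<epsilon>) * real n) = real CARD('a) ^ ((m - k) * (n div m))"
    if "k \<le> m"
  proof -
    have "real n = real m * real (n div m)" using assms(5) by (simp flip: of_nat_mult)
    then have "(1 - \<epsilon>) * real n = real ((m - k) * (n div m))"
      using that k_eq by (simp add: of_nat_diff algebra_simps)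
    then show ?thesis by (simp only: powr_realpow of_nat_0_less_iff zero_less_card_finite)
  qed
  have "real (card S) \<ge> 1 / 3 * real CARD('a) powr ((1 - \<epsilon>) * real n)"
    if \<epsilon>: "\<epsilon> \<le> 1 / 10" and d0: "real (d 0) \<le> real CARD('a) powr (1 / 4)" and n: "CARD('a) ^ m \<ge> n ^ 8"
  proof -
    define Q where "Q = real CARD('a) powr (1 / 4)"
    have Q: "Q ^ 4 = real CARD('a)" "Q \<ge> 1"
      unfolding Q_def using card_finite_field_gt_1[where 'a = 'a]
      by (simp_all add: powr_power ge_one_powr_ge_zero)
    have d_le: "real (d j) \<le> Q" if "j < m" for j
    proof -
      have "d j \<le> d 0" using assms(8)[of 0 j] that by (cases j) auto
      then show ?thesis using d0 unfolding Q_def by linarith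
    qed
    have "10 * real k \<le> m" using mult_right_mono[OF \<epsilon>, of m] k_eq by simp
    then have k10: "10 * k \<le> m" by linarith
    show ?thesis
      using card_evasive_set_ge[OF assms(6,7,2) k10 assms(5,9) d_le Q n] powr k10
      by (simp add: S_def)
  qed
  moreover have "real (card S) = real CARD('a) powr ((1 - \<epsilon>) * real n)"
    if many: "card {j. j < m \<and> coprime (d j) (CARD('a) - 1)} \<ge> k"
  proof -
    have "card {j. j < m \<and> coprime (d j) (CARD('a) - 1)} \<le> card {..<m}"
      by (intro card_mono) auto
    then have "k \<le> m" using many by simp
    moreover have "card S = (CARD('a) ^ (m - k)) ^ (n div m)"
      using card_evasive_set[of A n d] assms(5,6) m
        card_common_zeros_coprime[OF assms(6,7,9) many] by (simp add: S_def)
    ultimately show ?thesis by (simp add: powr power_mult)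
  qed
  moreover have "subspace_evasive n k (d 0 ^ k) S"
    unfolding S_def by (rule subspace_evasive_evasive_set[OF assms(6) m assms(5,7-9)])
  ultimately show ?thesis by blast
qed

end
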